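(* For all $w,r\in\mathcal P$, $|w|^r$ exists; that is, every $w\in\mathcal P$ is the value of a (unique) term in $r$-DF.
   Context: $\mathcal P$ is the free algebra on one generator $x$ with two binary operations $\cdot$ (juxtaposition) and $\circ$, satisfying $a\circ(b\circ c)=(a\circ b)\circ c$, $(a\circ b)c=a(bc)$, $a(b\circ c)=ab\circ ac$, $a\circ b=ab\circ a$. Products are left-associated: $p_0p_1\cdots p_n=(\cdots(p_0p_1)\cdots)p_n$, $p_0\cdots p_{n-1}\circ p_n=(p_0\cdots p_{n-1})\circ p_n$, and $p_0\cdots p_{n-1}\ast p_n$ denotes either (same for formal terms). $p<_L q$ means $q=pa_0\cdots a_{n-1}\ast a_n$ for some $n\ge0$, $a_i\in\mathcal P$; $<_L$ is a linear order on $\mathcal P$, $\le_L$ is $<_L$ or $=$. Iterates: $I_1(a,b)=a$, $I_2(a,b)=ab$, $I_{n+2}(a,b)=I_{n+1}(a,b)I_n(a,b)$. A term $b_0\cdots b_{n-1}\ast b_n$ is prenormal w.r.t. a linear order $\prec$ if $b_{k+2}\preceq b_0\cdots b_k$ for $0\le k\le n-2$, and if $\ast=\circ$ and $n\ge2$ also $b_n\prec b_0\cdots b_{n-2}$. For $r\in\mathcal P$, $r$-DF is the set of formal terms over the alphabet $\{s: s\le_L r\}$ defined by simultaneous recursion with a linear order $<_{\mathrm{Lex}}$: each $s\le_L r$ (length-one term) is in $r$-DF; a longer term is in $r$-DF iff it is $ra_0a_1\cdots a_{n-1}\ast a_n$ ($n\ge0$) with all $a_i\in r$-DF and the term prenormal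 w.r.t. $<_{\mathrm{Lex}}$; $<_{\mathrm{Lex}}$ is the lexicographic comparison of associated sequences (a proper initial segment is smaller; length-one terms compared by $<_L$), where the associated sequence of a length-one term $w$ is $\langle w\rangle$, of $ra_0\cdots a_n$ is $\langle r,a_0,\dots,a_n\rangle$, and of $ra_0\cdots a_{n-1}\circ a_n$ (with $u=ra_0\cdots a_{n-1}$) is $\langle r,a_0,\dots,a_n,I_1(u,a_n),I_2(u,a_n),\dots\rangle$. It is known that $<_{\mathrm{Lex}}$ agrees with $<_L$ on values, so each element $w$ is the value of at most one $r$-DF term; $|w|^r$ denotes this term when it exists. *)

theory Defs
  imports Main
begin

datatype 'a trm = Var 'a | App "'a trm" "'a trm" (infixl "\<cdot>" 70) | Comp "'a trm" "'a trm" (infixl "\<odot>" 65)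

inductive laws :: "'a trm \<Rightarrow> 'a trm \<Rightarrow> bool" where
  refl: "laws a a"
| sym: "laws a b \<Longrightarrow> laws b a"
| trans: "laws a b \<Longrightarrow> laws b c \<Longrightarrow> laws a c"
| app_cong: "laws a a' \<Longrightarrow> laws b b' \<Longrightarrow> laws (a \<cdot> b) (a' \<cdot> b')"
| comp_cong: "laws a a' \<Longrightarrow> laws b b' \<Longrightarrow> laws (a \<odot> b) (a' \<odot> b')"
| comp_assoc: "laws (a \<odot> (b \<odot> c)) ((a \<odot> b) \<odot> c)"
| comp_app: "laws ((a \<odot> b) \<cdot> c) (a \<cdot> (b \<cdot> c))"
| app_comp: "laws (a \<cdot> (b \<odot> c)) ((a \<cdot> b) \<odot> (a \<cdot> c))"
| comp_app_comp: "laws (a \<odot> b) ((a \<cdot> b) \<odot> a)"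

quotient_type P = "unit trm" / laws
  by (rule equivpI) (auto intro: reflpI sympI transpI laws.intros)

lift_definition gen :: P is "Var ()" .

lift_definition papp :: "P \<Rightarrow> P \<Rightarrow> P" (infixl "\<cdot>\<^sub>P" 70) is App
  by (rule laws.app_cong)

lift_definition pcomp :: "P \<Rightarrow> P \<Rightarrow> P" (infixl "\<circ>\<^sub>P" 65) is Comp
  by (rule laws.comp_cong)

definition lessL :: "P \<Rightarrow> P \<Rightarrow> bool" (infix "<\<^sub>L" 50) where
  "p <\<^sub>L q \<longleftrightarrow> (\<exists>as a. q = foldl papp p as \<cdot>\<^sub>P a \<or> q = foldl papp p as \<circ>\<^sub>P a)"

abbreviation leL :: "P \<Rightarrow> P \<Rightarrow> bool" (infix "\<le>\<^sub>L" 50) where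
  "p \<le>\<^sub>L q \<equiv> p <\<^sub>L q \<or> p = q"

text \<open>Formal terms over a set of elements of \<^typ>\<open>P\<close> are of type \<^typ>\<open>P trm\<close>.\<close>

primrec val :: "P trm \<Rightarrow> P" where
  "val (Var p) = p"
| "val (s \<cdot> t) = val s \<cdot>\<^sub>P val t"
| "val (s \<odot> t) = val s \<circ>\<^sub>P val t"

datatype opsym = Dot | Circ

fun star :: "opsym \<Rightarrow> 'a trm \<Rightarrow> 'a trm \<Rightarrow> 'a trm" where
  "star Dot s t = s \<cdot> t"
| "star Circ s t = s \<odot> t"

text \<open>Indices are shifted by one: \<^term>\<open>iter n a b\<close> is the iterate $I_{n+1}(a,b)$.\<close>

fun iter :: "nat \<Rightarrow> 'a trm \<Rightarrow> 'a trm \<Rightarrow> 'a trm" where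
  "iter 0 a b = a"
| "iter (Suc 0) a b = a \<cdot> b"
| "iter (Suc (Suc n)) a b = iter (Suc n) a b \<cdot> iter n a b"

definition lprod :: "'a trm list \<Rightarrow> 'a trm" where
  "lprod bs = foldl App (hd bs) (tl bs)"

text \<open>The term $b_0 \cdots b_{n-1} \ast b_n$ is given by the list \<open>bs\<close> of its \<open>n + 1\<close> factors
  and the operation symbol \<open>c\<close> standing for $\ast$.\<close>

definition prenormal :: "('a trm \<Rightarrow> 'a trm \<Rightarrow> bool) \<Rightarrow> 'a trm list \<Rightarrow> opsym \<Rightarrow> bool" where
  "prenormal lt bs c \<longleftrightarrow>
     (\<forall>k. k + 2 < length bs \<longrightarrow>
        (lt (bs ! (k + 2)) (lprod (take (k + 1) bs)) \<or> bs ! (k + 2) = lprod (take (k + 1) bs))) \<and>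
     (c = Circ \<and> length bs \<ge> 3 \<longrightarrow> lt (last bs) (lprod (take (length bs - 2) bs)))"

lemma prenormal_mono [mono]:
  assumes "\<And>s t. lt s t \<longrightarrow> lt' s t"
  shows "prenormal lt bs c \<longrightarrow> prenormal lt' bs c"
  using assms unfolding prenormal_def by blast

primrec factors :: "'a trm \<Rightarrow> 'a trm list" where
  "factors (Var w) = [Var w]"
| "factors (u \<cdot> a) = factors u @ [a]"
| "factors (u \<odot> a) = factors u @ [a]"

text \<open>The associated sequence, with value \<^const>\<open>None\<close> beyond its end.  It is meaningful for
  terms $w$, $w a_0 \cdots a_n$ and $w a_0 \cdots a_{n-1} \circ a_n$ with $w$ of length one.\<close>

definition assoc_seq :: "'a trm \<Rightarrow> nat \<Rightarrow> 'a trm option" where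
  "assoc_seq t i =
     (if i < length (factors t) then Some (factors t ! i)
      else case t of u \<odot> a \<Rightarrow> Some (iter (i - length (factors t)) u a) | _ \<Rightarrow> None)"

text \<open>The least solution of the simultaneous recursion: any two distinct members of \<open>DF r\<close>
  are compared in finitely many steps, since a comparison with an entry of the infinite tail
  of an associated sequence is settled by prenormality.\<close>

inductive DF :: "P \<Rightarrow> P trm \<Rightarrow> bool" and Lex :: "P \<Rightarrow> P trm \<Rightarrow> P trm \<Rightarrow> bool" for r :: P where
  DF_atom: "s \<le>\<^sub>L r \<Longrightarrow> DF r (Var s)"
| DF_longer:
    "\<lbrakk>\<forall>b\<in>set as. DF r b; DF r a; prenormal (Lex r) (Var r # as @ [a]) c\<rbrakk>
     \<Longrightarrow> DF r (star c (lprod (Var r # as)) a)"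
| Lex_atom: "\<lbrakk>DF r (Var s); DF r (Var t); s <\<^sub>L t\<rbrakk> \<Longrightarrow> Lex r (Var s) (Var t)"
| Lex_initial:
    "\<lbrakk>DF r s; DF r t; \<forall>i<k. assoc_seq s i = assoc_seq t i;
      assoc_seq s k = None; assoc_seq t k \<noteq> None\<rbrakk> \<Longrightarrow> Lex r s t"
| Lex_differ:
    "\<lbrakk>DF r s; DF r t; \<forall>i<k. assoc_seq s i = assoc_seq t i;
      assoc_seq s k = Some a; assoc_seq t k = Some b; Lex r a b\<rbrakk> \<Longrightarrow> Lex r s t"

end

(* The proof follows Laver's comparison of division forms over different bases.

   Irreflexivity of the left-division order comes from a braid-like model: bijections of sequences over
   pairs of positive reals, with f * g = f sh(g) sigma sh(f)^-1, where sigma is the subtraction-free form of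
   Dynnikov's action; sigma strictly increases the first coordinate and shifted maps fix it.

   Call D the set of values of gen-division forms.  One shows, by induction on u, that D is also the set
   of values of u-division forms whose length-one terms are taken from D.  The key formula is
   (w p)((w h0) h1) = (w (p o h0)) h1 for h1 <= w: it turns a product whose right factor extends w into one
   where the prenormality conditions hold again, and what has to be reduced next is the product p o h0 of
   shorter pieces (extendible_left_mult).  For u = b o s the first component c0 of a division form need
   not be simpler than the form itself; there one argues by induction on the number m with c0 below
   b(b(...(b b))).  Since D contains gen and u D is contained in D for all u, D is everything. *)

theory Submission
  imports Complex_Main Defs
begin

section \<open>A left-distributive algebra without left-division cycles\<close>

text \<open>Linearity of \<open><\<^sub>L\<close> is not at hand while the argument runs; only
  irreflexivity is, from the model. Hence P is made a partial order, comparability is assumed on D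
  alone, and linearity of P falls out once D is everything. Almost every comparison rests on one
  inequality: a < b implies c \<circ> a < c b. So the intervals from c a to c \<circ> a are disjoint
  for different comparable a, and prenormality keeps every product that starts with c a inside the
  interval of a. The obstacle to left multiplication: after the prefix w p the next factor must be
  at most w. If it is, nothing has to be done. If it exceeds w, disjointness of intervals forces w
  to be one of its prefixes, and this common w can be absorbed. All this concerns values, where the
  simultaneous recursion of \<open>DF\<close> and \<open>Lex\<close> is replaced by the order of P.
  The way back to formal terms needs that \<open>Lex\<close> is total on \<open>DF\<close>; the
  difficulty there is the infinite associated sequences, whose entries may be larger than the term
  they come from.\<close>

typedef pos2 = "{p::real \<times> real. fst p > 0 \<and> snd p > 0}"
  by (rule exI[of _ "(1,1)"]) simp

setup_lifting type_definition_pos2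

text \<open>Dynnikov's formulas for the action of a braid generator on two pairs of coordinates, with maximum
  and addition replaced by addition and multiplication.\<close>

lift_definition dyn_left :: "pos2 \<Rightarrow> pos2 \<Rightarrow> pos2" is
  "\<lambda>p q. (fst p * (1 + snd p) + snd p * fst q,
          snd p * snd q / (snd p + fst p * (1 + snd p) * (1 + snd q) / fst q))"
  by (simp add: add_pos_pos)

lift_definition dyn_right :: "pos2 \<Rightarrow> pos2 \<Rightarrow> pos2" is
  "\<lambda>p q. (fst p * fst q * snd q / (fst q + fst p * (1 + snd q)),
          snd p + fst p * (1 + snd p) * (1 + snd q) / fst q)"
  by (simp add: add_pos_pos)

text \<open>A mirror reflection: conjugating \<open>sigma_fun\<close> by it gives the inverse map,
  see \<open>flip_sigma\<close>.\<close>

lift_definition flip :: "pos2 \<Rightarrow> pos2" is "\<lambda>p. (1 / fst p, snd p)" by simp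

lift_definition height :: "pos2 \<Rightarrow> real" is fst .

lemma flip_flip [simp]: "flip (flip p) = p"
  by transfer auto

lemma height_dyn_left: "height (dyn_left p q) > height p"
  by transfer (simp add: distrib_left add_pos_pos)

lemma pos_neq_0: "0 < (x::real) \<Longrightarrow> x \<noteq> 0" by simp

lift_definition width :: "pos2 \<Rightarrow> real" is snd .

lemma width_pos: "0 < width p"
  by transfer simp

lemma width_neq_0 [simp]: "width p \<noteq> 0"
  using width_pos[of p] by simp

lemma pos2_eqI: "height p = height q \<Longrightarrow> width p = width q \<Longrightarrow> p = q"
  by transfer (rule prod_eqI)

lemma dyn_inverse:
  "dyn_left (flip (dyn_left p q)) (flip (dyn_right p q)) = flip p" "dyn_right (flip (dyn_left p q)) (flip (dyn_right p q)) = flip q"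
  by (transfer, clarsimp, intro conjI; simp add: divide_simps add_pos_pos pos_neq_0; algebra)+

text \<open>This invariant spares a computation in \<open>yang_baxter_mid\<close>: the product of
  three second coordinates and two of them determine the third.\<close>

lemma width_dyn: "width (dyn_left p q) * width (dyn_right p q) = width p * width q"
  by transfer (simp add: divide_simps add_pos_pos pos_neq_0)

text \<open>The three Yang-Baxter identities are the three coordinates of the relation
  \<open>braid\<close>.\<close>

lemma yang_baxter_left: "dyn_left (dyn_left a b) (dyn_left (dyn_right a b) c) = dyn_left a (dyn_left b c)"
  by (transfer, clarsimp, intro conjI; simp add: divide_simps add_pos_pos pos_neq_0; algebra)

lemma yang_baxter_right: "dyn_right (dyn_right a b) c = dyn_right (dyn_right a (dyn_left b c)) (dyn_right b c)"
  by (transfer, clarsimp, intro conjI; simp add: divide_simps add_pos_pos pos_neq_0; algebra)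

lemma yang_baxter_mid: "dyn_right (dyn_left a b) (dyn_left (dyn_right a b) c) = dyn_left (dyn_right a (dyn_left b c)) (dyn_right b c)" (is "?p = ?q")
proof (rule pos2_eqI)
  show "height ?p = height ?q"
    by (transfer, clarsimp, simp add: divide_simps add_pos_pos pos_neq_0, algebra)
  have "width (dyn_left (dyn_left a b) (dyn_left (dyn_right a b) c)) * width ?p * width (dyn_right (dyn_right a b) c)
      = width (dyn_left a b) * (width (dyn_left (dyn_right a b) c) * width (dyn_right (dyn_right a b) c))"
    by (simp only: width_dyn mult.assoc)
  also have "\<dots> = width (dyn_left a b) * width (dyn_right a b) * width c"
    unfolding width_dyn[of "dyn_right a b" c] by (simp only: mult.assoc)
  also have "\<dots> = width a * (width b * width c)"
    by (simp only: width_dyn mult.assoc[of "width a"])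
  also have "\<dots> = width a * width (dyn_left b c) * width (dyn_right b c)"
    by (simp only: width_dyn mult.assoc)
  also have "\<dots> = width (dyn_left a (dyn_left b c)) * (width (dyn_right a (dyn_left b c)) * width (dyn_right b c))"
    by (simp only: width_dyn flip: mult.assoc)
  also have "\<dots> = width (dyn_left a (dyn_left b c)) * width ?q * width (dyn_right (dyn_right a (dyn_left b c)) (dyn_right b c))"
    by (simp only: width_dyn mult.assoc)
  finally show "width ?p = width ?q"
    by (simp add: yang_baxter_left flip: yang_baxter_right)
qed

section \<open>The group of bijections of sequences and the braid relations\<close>

typedef perm = "{f::(nat \<Rightarrow> pos2) \<Rightarrow> (nat \<Rightarrow> pos2). bij f}"
  by (rule exI[of _ id]) simp

setup_lifting type_definition_perm

instantiation perm :: group_add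
begin
lift_definition zero_perm :: perm is id by simp
lift_definition plus_perm :: "perm \<Rightarrow> perm \<Rightarrow> perm" is "(\<circ>)" by (rule bij_comp)
lift_definition uminus_perm :: "perm \<Rightarrow> perm" is inv by (rule bij_imp_bij_inv)
definition minus_perm :: "perm \<Rightarrow> perm \<Rightarrow> perm" where "minus_perm a b = a + - b"
instance
proof
  fix a b c :: perm
  show "a + b + c = a + (b + c)" by transfer (simp add: fun_eq_iff)
  show "0 + a = a" by transfer simp
  show "a + 0 = a" by transfer simp
  show "- a + a = 0" by transfer (simp add: bij_is_inj)
  show "a + - b = a - b" by (simp add: minus_perm_def)
qed
end

text \<open>On braids this is the embedding that moves every generator up by one index.\<close>

lift_definition shift :: "perm \<Rightarrow> perm" is "\<lambda>f s. case_nat (s 0) (f (\<lambda>n. s (Suc n)))"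
proof -
  fix f :: "(nat \<Rightarrow> pos2) \<Rightarrow> (nat \<Rightarrow> pos2)" assume f: "bij f"
  show "bij (\<lambda>s. case_nat (s 0) (f (\<lambda>n. s (Suc n))))"
  proof (rule bij_betw_byWitness[where f' = "\<lambda>s. case_nat (s 0) (inv f (\<lambda>n. s (Suc n)))"])
    show "\<forall>s\<in>UNIV. case_nat (case_nat (s 0) (f (\<lambda>n. s (Suc n))) 0)
        (inv f (\<lambda>n. case_nat (s 0) (f (\<lambda>n. s (Suc n))) (Suc n))) = s"
      using f by (auto simp: fun_eq_iff bij_is_inj split: nat.split)
    show "\<forall>s\<in>UNIV. case_nat (case_nat (s 0) (inv f (\<lambda>n. s (Suc n))) 0)
        (f (\<lambda>n. case_nat (s 0) (inv f (\<lambda>n. s (Suc n))) (Suc n))) = s"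
      using f by (auto simp: fun_eq_iff bij_is_surj surj_f_inv_f split: nat.split)
  qed auto
qed

definition sigma_fun :: "(nat \<Rightarrow> pos2) \<Rightarrow> (nat \<Rightarrow> pos2)" where
  "sigma_fun s = s(0 := dyn_left (s 0) (s 1), 1 := dyn_right (s 0) (s 1))"

lemma flip_sigma: "flip \<circ> sigma_fun (flip \<circ> sigma_fun s) = s"
  by (auto simp: fun_eq_iff sigma_fun_def dyn_inverse)

lemma bij_sigma_fun: "bij sigma_fun"
proof (rule bij_betw_byWitness[where f' = "\<lambda>s. flip \<circ> sigma_fun (flip \<circ> s)"])
  have "flip \<circ> (flip \<circ> s) = s" for s :: "nat \<Rightarrow> pos2" by (simp add: fun_eq_iff)
  then show "\<forall>s\<in>UNIV. sigma_fun (flip \<circ> sigma_fun (flip \<circ> s)) = s"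
    using flip_sigma by metis
qed (auto simp: flip_sigma)

lift_definition sigma :: perm is sigma_fun by (rule bij_sigma_fun)

lemma shift_add: "shift (f + g) = shift f + shift g"
  by transfer (simp add: fun_eq_iff)

lemma shift_uminus: "shift (- f) = - shift f"
proof -
  have "shift 0 = 0" by transfer (auto simp: fun_eq_iff split: nat.split)
  then have "shift (- f) + shift f = 0" by (metis add.left_inverse shift_add)
  then show ?thesis by (simp add: eq_neg_iff_add_eq_0)
qed

lemma sigma_shift2: "sigma + shift (shift f) = shift (shift f) + sigma"
proof (transfer, rule ext)
  fix f :: "(nat \<Rightarrow> pos2) \<Rightarrow> (nat \<Rightarrow> pos2)" and s :: "nat \<Rightarrow> pos2"
  let ?sh = "\<lambda>f s. case_nat (s 0) (f (\<lambda>n. s (Suc n)))"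
  obtain a b u where s: "s = case_nat a (case_nat b u)"
  proof
    show "s = case_nat (s 0) (case_nat (s 1) (\<lambda>n. s (Suc (Suc n))))"
      by (rule ext) (simp split: nat.split)
  qed
  have 1: "sigma_fun (case_nat a (case_nat b u)) = case_nat (dyn_left a b) (case_nat (dyn_right a b) u)" for a b u
    by (rule ext) (simp add: sigma_fun_def split: nat.split)
  show "(sigma_fun \<circ> ?sh (?sh f)) s = (?sh (?sh f) \<circ> sigma_fun) s"
    by (simp add: s 1)
qed

lemma braid: "sigma + shift sigma + sigma = shift sigma + sigma + shift sigma"
proof (transfer, rule ext)
  fix s :: "nat \<Rightarrow> pos2"
  let ?sh = "\<lambda>f s. case_nat (s 0) (f (\<lambda>n. s (Suc n)))"
  obtain a b c u where s: "s = case_nat a (case_nat b (case_nat c u))"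
  proof
    show "s = case_nat (s 0) (case_nat (s 1) (case_nat (s 2) (\<lambda>n. s (Suc (Suc (Suc n))))))"
      by (rule ext) (simp add: eval_nat_numeral split: nat.split)
  qed
  have 1: "sigma_fun (case_nat a (case_nat b u)) = case_nat (dyn_left a b) (case_nat (dyn_right a b) u)" for a b u
    by (rule ext) (simp add: sigma_fun_def split: nat.split)
  show "(sigma_fun \<circ> ?sh sigma_fun \<circ> sigma_fun) s = (?sh sigma_fun \<circ> sigma_fun \<circ> ?sh sigma_fun) s"
    by (simp add: s 1 yang_baxter_left yang_baxter_mid flip: yang_baxter_right)
qed

text \<open>Dehornoy's bracket on braids, carried over to bijections.\<close>

definition ld :: "perm \<Rightarrow> perm \<Rightarrow> perm" (infixl "\<star>" 70) where
  "f \<star> g = f + shift g + sigma - shift f"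

lemma ld_distrib: "f \<star> (g \<star> h) = f \<star> g \<star> (f \<star> h)"
proof -
  have c': "sigma + (shift (shift f) + z) = shift (shift f) + (sigma + z)" for f z
    using sigma_shift2[of f] by (simp only: flip: add.assoc)
  then have c: "- shift (shift f) + (sigma + (shift (shift f) + z)) = sigma + z" for z
    by (simp only: minus_add_cancel)
  \<comment> \<open>The braid relation enters here: this is what remains of the distributive law
    after the doubly shifted maps have been moved past \<open>sigma\<close>.\<close>
  have b: "sigma + (shift sigma + (sigma + (- shift sigma + z))) = shift sigma + (sigma + z)" for z
  proof -
    have "sigma + (shift sigma + (sigma + (- shift sigma + z)))
        = (sigma + shift sigma + sigma) + (- shift sigma + z)"
      by (simp only: add.assoc)
    also have "\<dots> = shift sigma + (sigma + z)"
      unfolding braid by (simp only: add.assoc add_minus_cancel)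
    finally show ?thesis .
  qed
  have d: "sigma + (- shift (shift f) + z) = - shift (shift f) + (sigma + z)" for f z
    using c'[of "- f"] by (simp add: shift_uminus)
  show ?thesis
    unfolding ld_def diff_conv_add_uminus shift_add shift_uminus minus_add add.assoc
    by (simp del: add_uminus_conv_diff add: c b c' d add.assoc minus_add)
qed

lemma height_sigma: "height (s 0) < height (sigma_fun s 0)"
  by (simp add: sigma_fun_def height_dyn_left)

abbreviation apply_perm :: "perm \<Rightarrow> (nat \<Rightarrow> pos2) \<Rightarrow> nat \<Rightarrow> pos2" where
  "apply_perm \<equiv> Rep_perm"

lemma apply_perm_simps:
  "apply_perm (f + g) s = apply_perm f (apply_perm g s)" "apply_perm 0 s = s" "apply_perm (shift f) s 0 = s 0"
  "height (s 0) < height (apply_perm sigma s 0)"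
  by (simp_all add: plus_perm.rep_eq zero_perm.rep_eq shift.rep_eq sigma.rep_eq height_sigma)

definition below :: "perm \<Rightarrow> perm \<Rightarrow> bool" (infix "\<lless>" 50) where
  "below = (\<lambda>f g. \<exists>h. g = f \<star> h)\<^sup>+\<^sup>+"

lemma below_ld: "f \<lless> f \<star> g"
  unfolding below_def by blast

lemma below_trans [trans]: "f \<lless> g \<Longrightarrow> g \<lless> h \<Longrightarrow> f \<lless> h"
  unfolding below_def by (rule tranclp_trans)

text \<open>The quotient of f \<star> h by f is \<open>shift h + sigma + shift (- f)\<close>: one
  positive \<open>sigma\<close> between shifted maps, which leave coordinate 0 alone. Quotients
  along a chain multiply, so every link adds to the height.\<close>

lemma below_height: "f \<lless> g \<Longrightarrow> height (s 0) < height (apply_perm (- f + g) s 0)"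
proof (unfold below_def, induction arbitrary: s rule: tranclp_induct)
  case (base g)
  then obtain h where g: "- f + g = shift h + sigma + shift (- f)"
    by (auto simp: ld_def shift_uminus add.assoc simp flip: add_uminus_conv_diff)
  show ?case
    unfolding g apply_perm_simps using apply_perm_simps(4)[of "apply_perm (shift (- f)) s"] by (simp add: apply_perm_simps)
next
  case (step g g')
  then obtain h where "g' = g \<star> h" by blast
  then have g': "- f + g' = (- f + g) + (shift h + (sigma + shift (- g)))"
    by (simp add: ld_def shift_uminus add.assoc flip: add_uminus_conv_diff)
  have "height (s 0) < height (apply_perm sigma (apply_perm (shift (- g)) s) 0)"
    using apply_perm_simps(4)[of "apply_perm (shift (- g)) s"] by (simp add: apply_perm_simps)
  also have "\<dots> = height (apply_perm (shift h) (apply_perm sigma (apply_perm (shift (- g)) s)) 0)"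
    by (simp add: apply_perm_simps)
  also have "\<dots> < height (apply_perm (- f + g') s 0)"
    unfolding g' using step.IH[of "apply_perm (shift h) (apply_perm sigma (apply_perm (shift (- g)) s))"]
    by (simp add: apply_perm_simps)
  finally show ?case .
qed

lemma below_irrefl: "\<not> f \<lless> f"
  using below_height[of f f "undefined"] by (auto simp: apply_perm_simps)

definition ld_hom :: "(perm \<Rightarrow> perm) \<Rightarrow> bool" where
  "ld_hom h \<longleftrightarrow> (\<forall>f g. h (f \<star> g) = h f \<star> h g)"

lemma ld_hom_below:
  assumes h: "ld_hom h" and fg: "f \<lless> g"
  shows "h f \<lless> h g"
  using fg[unfolded below_def]
proof (induction rule: tranclp_induct)
  case (base g)
  then show ?case using h below_ld by (auto simp: ld_hom_def)
next
  case (step g g')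
  then show ?case using h below_ld below_trans by (fastforce simp: ld_hom_def)
qed

section \<open>Interpretation of P by composites of left translations\<close>

abbreviation act :: "perm list \<Rightarrow> perm \<Rightarrow> perm" where
  "act fs g \<equiv> foldr (\<star>) fs g"

text \<open>A list stands for the composite of the left translations by its entries, so that \<circ>
  becomes concatenation. The generator goes to the identity permutation.\<close>

primrec interp :: "unit trm \<Rightarrow> perm list" where
  "interp (Var _) = [0]"
| "interp (s \<cdot> t) = map (act (interp s)) (interp t)"
| "interp (s \<odot> t) = interp s @ interp t"

lemma ld_hom_act: "ld_hom (act fs)"
  by (induction fs) (auto simp: ld_hom_def simp flip: ld_distrib)

lemma ld_hom_apply_act: "ld_hom h \<Longrightarrow> h (act fs g) = act (map h fs) (h g)"
  by (induction fs) (auto simp: ld_hom_def)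

lemma ld_hom_comp: "ld_hom h \<Longrightarrow> ld_hom k \<Longrightarrow> ld_hom (h \<circ> k)"
  by (auto simp: ld_hom_def)

text \<open>Two terms are interpreted by lists that may differ, but they act in the same way even after
  applying an endomorphism; this stronger invariant is what survives under application.\<close>

lemma laws_act:
  "laws s t \<Longrightarrow> ld_hom h \<Longrightarrow> act (map h (interp s)) g = act (map h (interp t)) g"
proof (induction arbitrary: h g rule: laws.induct)
  case (app_cong a a' b b')
  have "act (interp a) = act (interp a')"
    using app_cong.IH(1)[of id] by (auto simp: ld_hom_def fun_eq_iff)
  moreover have "act (map (h \<circ> act (interp a)) (interp b)) g = act (map (h \<circ> act (interp a)) (interp b')) g"
    using app_cong.prems ld_hom_act ld_hom_comp by (intro app_cong.IH(2)) blast
  ultimately show ?case by simp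
next
  case (comp_app a b c)
  have "act (interp a @ interp b) = act (interp a) \<circ> act (interp b)" by auto
  then show ?case by (simp add: comp_def)
next
  case (comp_app_comp a b)
  let ?f = "act (map h (interp a))"
  have "?f (act (map h (interp b)) g) = act (map ?f (map h (interp b))) (?f g)"
    by (rule ld_hom_apply_act) (rule ld_hom_act)
  also have "map ?f (map h (interp b)) = map h (map (act (interp a)) (interp b))"
    using ld_hom_apply_act[OF comp_app_comp.prems] by simp
  finally show ?case by simp
qed auto

text \<open>The list depends on the representing term, its action does not. Evaluating the action at
  \<open>0\<close>, the image of the generator, gives the permutation that belongs to p x.\<close>

lift_definition actP :: "P \<Rightarrow> perm" is "\<lambda>t. act (interp t) 0"
  using laws_act[where h = id] by (simp add: ld_hom_def)

lemma act_Cons_below: "f \<lless> act (f # fs) g"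
  by (simp add: below_ld)

text \<open>Left translations preserve \<open>below\<close>, so in \<open>actP_app\<close> and
  \<open>actP_comp\<close> it suffices that the right factor contributes nothing lower than the base
  point \<open>0\<close>.\<close>

lemma interp_ge: "f \<in> set (interp t) \<Longrightarrow> f = 0 \<or> 0 \<lless> f" and interp_ne: "interp t \<noteq> []"
proof (induction t arbitrary: f)
  case (App s t)
  { case 1
    then obtain f' where f': "f' \<in> set (interp t)" "f = act (interp s) f'" by auto
    obtain g gs where s: "interp s = g # gs" using App.IH(2) by (cases "interp s") auto
    have "0 \<lless> act (interp s) 0"
      using App.IH(1)[of g] act_Cons_below[of g gs 0] below_trans by (auto simp: s)
    moreover have "act (interp s) 0 = f \<or> act (interp s) 0 \<lless> f"
      using App.IH(3)[OF f'(1)] ld_hom_below[OF ld_hom_act] f'(2) by auto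
    ultimately show ?case using below_trans by auto
  next
    case 2
    then show ?case using App.IH by simp
  }
qed auto

lemma actP_app: "actP p \<lless> actP (p \<cdot>\<^sub>P q)"
proof transfer
  fix s t :: "unit trm"
  obtain g gs where t: "interp t = g # gs" using interp_ne by (cases "interp t") auto
  have "act (interp s) 0 = act (interp s) g \<or> act (interp s) 0 \<lless> act (interp s) g"
    using interp_ge[of g t] ld_hom_below[OF ld_hom_act] by (auto simp: t)
  then show "act (interp s) 0 \<lless> act (interp (s \<cdot> t)) 0"
    using below_ld below_trans by (auto simp: t)
qed

lemma actP_comp: "actP p \<lless> actP (p \<circ>\<^sub>P q)"
proof transfer
  fix s t :: "unit trm"
  obtain g gs where t: "interp t = g # gs" using interp_ne by (cases "interp t") auto
  have "0 \<lless> act (interp t) 0"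
    using interp_ge[of g t] act_Cons_below[of g gs 0] below_trans by (auto simp: t)
  then show "act (interp s) 0 \<lless> act (interp (s \<odot> t)) 0"
    using ld_hom_below[OF ld_hom_act] by simp
qed

lemma lessL_irrefl: "\<not> p <\<^sub>L p"
proof -
  have *: "actP p = actP (foldl papp p as) \<or> actP p \<lless> actP (foldl papp p as)" for as
  proof (induction as rule: rev_induct)
    case (snoc a as)
    then show ?case using actP_app below_trans by auto
  qed simp
  have "actP p \<lless> actP q" if pq: "p <\<^sub>L q" for q
  proof -
    obtain as a where "q = foldl papp p as \<cdot>\<^sub>P a \<or> q = foldl papp p as \<circ>\<^sub>P a"
      using pq unfolding lessL_def by blast
    then show ?thesis using *[of as] actP_app actP_comp below_trans by metis
  qed
  then show ?thesis using below_irrefl by blast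
qed

section \<open>The left-division order\<close>

lemma comp_papp: "(a \<circ>\<^sub>P b) \<cdot>\<^sub>P c = a \<cdot>\<^sub>P (b \<cdot>\<^sub>P c)"
  by transfer (rule laws.comp_app)

lemma papp_comp: "a \<cdot>\<^sub>P (b \<circ>\<^sub>P c) = (a \<cdot>\<^sub>P b) \<circ>\<^sub>P (a \<cdot>\<^sub>P c)"
  by transfer (rule laws.app_comp)

lemma pcomp_assoc: "(a \<circ>\<^sub>P b) \<circ>\<^sub>P c = a \<circ>\<^sub>P (b \<circ>\<^sub>P c)"
  by transfer (rule laws.sym[OF laws.comp_assoc])

lemma pcomp_eq: "a \<circ>\<^sub>P b = (a \<cdot>\<^sub>P b) \<circ>\<^sub>P a"
  by transfer (rule laws.comp_app_comp)

text \<open>Both sides are (a \<circ> b) c, the right one because a \<circ> b = a b \<circ>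
  a.\<close>

lemma papp_distrib: "a \<cdot>\<^sub>P (b \<cdot>\<^sub>P c) = (a \<cdot>\<^sub>P b) \<cdot>\<^sub>P (a \<cdot>\<^sub>P c)"
  by (metis comp_papp pcomp_eq)

lemma P_induct [case_names gen papp pcomp]:
  assumes "Q gen" "\<And>a b. Q a \<Longrightarrow> Q b \<Longrightarrow> Q (a \<cdot>\<^sub>P b)" "\<And>a b. Q a \<Longrightarrow> Q b \<Longrightarrow> Q (a \<circ>\<^sub>P b)"
  shows "Q p"
proof -
  have "Q (abs_P t)" for t
  proof (induction t)
    case (Var u)
    then show ?case using assms(1) by (cases u) (simp add: gen.abs_eq)
  next
    case (App s t)
    then show ?case using assms(2) by (simp flip: papp.abs_eq)
  next
    case (Comp s t)
    then show ?case using assms(3) by (simp flip: pcomp.abs_eq)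
  qed
  then show ?thesis by (metis P.abs_induct)
qed

lemma lessL_papp: "p <\<^sub>L p \<cdot>\<^sub>P a"
  unfolding lessL_def by (intro exI[of _ "[]"] exI[of _ a]) simp

lemma lessL_pcomp: "p <\<^sub>L p \<circ>\<^sub>P a"
  unfolding lessL_def by (intro exI[of _ "[]"] exI[of _ a]) simp

lemma lessL_papp_right: "p <\<^sub>L q \<Longrightarrow> p <\<^sub>L q \<cdot>\<^sub>P a"
proof -
  assume "p <\<^sub>L q"
  then obtain as b where "q = foldl papp p as \<cdot>\<^sub>P b \<or> q = foldl papp p as \<circ>\<^sub>P b"
    unfolding lessL_def by blast
  then have "q \<cdot>\<^sub>P a = foldl papp p (as @ [b]) \<cdot>\<^sub>P a \<or> q \<cdot>\<^sub>P a = foldl papp p as \<cdot>\<^sub>P (b \<cdot>\<^sub>P a)"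
    by (auto simp: comp_papp)
  then show ?thesis unfolding lessL_def by metis
qed

lemma lessL_pcomp_right: "p <\<^sub>L q \<Longrightarrow> p <\<^sub>L q \<circ>\<^sub>P a"
proof -
  assume "p <\<^sub>L q"
  then obtain as b where "q = foldl papp p as \<cdot>\<^sub>P b \<or> q = foldl papp p as \<circ>\<^sub>P b"
    unfolding lessL_def by blast
  then have "q \<circ>\<^sub>P a = foldl papp p (as @ [b]) \<circ>\<^sub>P a \<or> q \<circ>\<^sub>P a = foldl papp p as \<circ>\<^sub>P (b \<circ>\<^sub>P a)"
    by (auto simp: pcomp_assoc)
  then show ?thesis unfolding lessL_def by metis
qed

lemma lessL_induct [consumes 1, case_names papp pcomp papp_right pcomp_right]:
  assumes "p <\<^sub>L q" "\<And>a. Q (p \<cdot>\<^sub>P a)" "\<And>a. Q (p \<circ>\<^sub>P a)"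
    "\<And>q a. p <\<^sub>L q \<Longrightarrow> Q q \<Longrightarrow> Q (q \<cdot>\<^sub>P a)" "\<And>q a. p <\<^sub>L q \<Longrightarrow> Q q \<Longrightarrow> Q (q \<circ>\<^sub>P a)"
  shows "Q q"
proof -
  have *: "as = [] \<or> p <\<^sub>L foldl papp p as \<and> Q (foldl papp p as)" for as
  proof (induction as rule: rev_induct)
    case (snoc a as)
    then show ?case using assms(2,4) lessL_papp lessL_papp_right by auto
  qed simp
  obtain as b where "q = foldl papp p as \<cdot>\<^sub>P b \<or> q = foldl papp p as \<circ>\<^sub>P b"
    using assms(1) unfolding lessL_def by blast
  then show ?thesis using *[of as] assms(2-) by auto
qed

instantiation P :: order
begin
definition less_eq_P :: "P \<Rightarrow> P \<Rightarrow> bool" where "less_eq_P p q \<longleftrightarrow> p \<le>\<^sub>L q"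
definition less_P :: "P \<Rightarrow> P \<Rightarrow> bool" where "less_P p q \<longleftrightarrow> p <\<^sub>L q"
instance
proof
  have trans: "p <\<^sub>L q \<Longrightarrow> q <\<^sub>L r \<Longrightarrow> p <\<^sub>L r" for p q r
    by (rotate_tac, induction rule: lessL_induct) (auto intro: lessL_papp_right lessL_pcomp_right)
  fix p q r :: P
  show "p < q \<longleftrightarrow> p \<le> q \<and> \<not> q \<le> p" "p \<le> p"
    and "p \<le> q \<Longrightarrow> q \<le> r \<Longrightarrow> p \<le> r" "p \<le> q \<Longrightarrow> q \<le> p \<Longrightarrow> p = q"
    using trans lessL_irrefl unfolding less_eq_P_def less_P_def by blast+
qed
end

lemma less_papp [simp]: "p < p \<cdot>\<^sub>P a" and less_pcomp [simp]: "p < p \<circ>\<^sub>P a"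
  by (simp_all add: less_P_def lessL_papp lessL_pcomp)

lemma le_papp [simp]: "p \<le> p \<cdot>\<^sub>P a" and le_pcomp [simp]: "p \<le> p \<circ>\<^sub>P a"
  by (simp_all add: less_imp_le)

lemma gen_le: "gen \<le> p"
proof (induction p rule: P_induct)
  case (papp a b) then show ?case by (meson less_papp less_imp_le order_trans)
next
  case (pcomp a b) then show ?case by (meson less_pcomp less_imp_le order_trans)
qed simp

lemma papp_less_pcomp: "a \<cdot>\<^sub>P b < a \<circ>\<^sub>P b"
  by (metis less_pcomp pcomp_eq)

text \<open>If b = a z, then c b = (c \<circ> a) z. The case b = a \<circ> z reduces to this through
  a \<circ> z = a z \<circ> a, and any further factor of b, multiplied by c, is a factor of c
  b.\<close>

lemma pcomp_less_papp:
  assumes "a < b"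
  shows "c \<circ>\<^sub>P a < c \<cdot>\<^sub>P b"
  using assms unfolding less_P_def
proof (induction rule: lessL_induct)
  case (papp z)
  then show ?case by (metis comp_papp lessL_papp)
next
  case (pcomp z)
  then show ?case by (metis comp_papp lessL_papp lessL_pcomp_right papp_comp pcomp_eq)
next
  case (papp_right b z)
  then show ?case by (metis lessL_papp_right papp_distrib)
next
  case (pcomp_right b z)
  then show ?case by (metis lessL_pcomp_right papp_comp)
qed

lemma papp_mono_strict: "a < b \<Longrightarrow> c \<cdot>\<^sub>P a < c \<cdot>\<^sub>P b"
  using papp_less_pcomp pcomp_less_papp less_trans by blast

lemma pcomp_mono_strict: "a < b \<Longrightarrow> c \<circ>\<^sub>P a < c \<circ>\<^sub>P b"
  using papp_less_pcomp pcomp_less_papp less_trans by blast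

lemma pcomp_mono: "a \<le> b \<Longrightarrow> c \<circ>\<^sub>P a \<le> c \<circ>\<^sub>P b"
  using pcomp_mono_strict by (auto simp: le_less)

section \<open>Division forms on the level of values\<close>

definition comparable :: "P \<Rightarrow> P \<Rightarrow> bool" where
  "comparable p q \<longleftrightarrow> p < q \<or> p = q \<or> q < p"

text \<open>A prefix product \<open>p = b a\<^sub>0 \<dots> a\<^sub>k\<close> is accompanied by the bound \<open>q = b a\<^sub>0 \<dots> a\<^bsub>k-1\<^esub>\<close> that the next
  factor has to obey; \<^const>\<open>None\<close> means that there is no bound, as for the first factor.\<close>

fun le_opt :: "P \<Rightarrow> P option \<Rightarrow> bool" where
  "le_opt p None \<longleftrightarrow> True"
| "le_opt p (Some q) \<longleftrightarrow> p \<le> q"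

fun less_opt :: "P \<Rightarrow> P option \<Rightarrow> bool" where
  "less_opt p None \<longleftrightarrow> True"
| "less_opt p (Some q) \<longleftrightarrow> p < q"

text \<open>Strictness for \<open>Circ\<close> is what makes forms unique: p a \<circ> p has the
  same value as p \<circ> a.\<close>

fun prenorm :: "opsym \<Rightarrow> P option \<Rightarrow> P \<Rightarrow> P list \<Rightarrow> bool" where
  "prenorm c q p [] \<longleftrightarrow> False"
| "prenorm Dot q p [a] \<longleftrightarrow> le_opt a q"
| "prenorm Circ q p [a] \<longleftrightarrow> less_opt a q"
| "prenorm c q p (a # b # as) \<longleftrightarrow> le_opt a q \<and> prenorm c (Some p) (p \<cdot>\<^sub>P a) (b # as)"

fun pvalue :: "opsym \<Rightarrow> P \<Rightarrow> P list \<Rightarrow> P" where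
  "pvalue c p [] = p"
| "pvalue Dot p [a] = p \<cdot>\<^sub>P a"
| "pvalue Circ p [a] = p \<circ>\<^sub>P a"
| "pvalue c p (a # b # as) = pvalue c (p \<cdot>\<^sub>P a) (b # as)"

lemma less_opt_le: "less_opt a q \<Longrightarrow> le_opt a q"
  by (cases q) auto

lemma le_opt_trans: "a \<le> b \<Longrightarrow> le_opt b q \<Longrightarrow> le_opt a q"
  by (cases q) auto

lemma prenorm_hd: "prenorm c q p (a # as) \<Longrightarrow> le_opt a q"
  by (cases as; cases c) (auto intro: less_opt_le)

lemma prenorm_Cons: "as \<noteq> [] \<Longrightarrow> prenorm c q p (a # as) \<longleftrightarrow> le_opt a q \<and> prenorm c (Some p) (p \<cdot>\<^sub>P a) as"
  by (cases as) auto

lemma pvalue_Cons: "as \<noteq> [] \<Longrightarrow> pvalue c p (a # as) = pvalue c (p \<cdot>\<^sub>P a) as"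
  by (cases as) auto

text \<open>The next factor b satisfies b \<le> p, so (p a) \<circ> b \<le> (p a) \<circ> p = p
  \<circ> a: the interval of each further factor lies inside the preceding one.\<close>

lemma pvalue_bounds:
  "prenorm c q p (a # as) \<Longrightarrow> p \<cdot>\<^sub>P a \<le> pvalue c p (a # as) \<and> pvalue c p (a # as) \<le> p \<circ>\<^sub>P a"
proof (induction as arbitrary: q p a)
  case Nil
  then show ?case using papp_less_pcomp[of p a] by (cases c) auto
next
  case (Cons b as)
  then have b: "b \<le> p" and "prenorm c (Some p) (p \<cdot>\<^sub>P a) (b # as)"
    using prenorm_hd[of c "Some p" "p \<cdot>\<^sub>P a" b as] by auto
  with Cons.IH have "p \<cdot>\<^sub>P a \<cdot>\<^sub>P b \<le> pvalue c p (a # b # as)"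
      "pvalue c p (a # b # as) \<le> (p \<cdot>\<^sub>P a) \<circ>\<^sub>P b" by auto
  moreover have "(p \<cdot>\<^sub>P a) \<circ>\<^sub>P b \<le> p \<circ>\<^sub>P a"
    unfolding pcomp_eq[of p a] by (rule pcomp_mono[OF b])
  moreover have "p \<cdot>\<^sub>P a < p \<cdot>\<^sub>P a \<cdot>\<^sub>P b" by simp
  ultimately show ?case by (meson less_imp_le order_trans)
qed

lemma less_pvalue: "prenorm c q p as \<Longrightarrow> p < pvalue c p as"
  using pvalue_bounds[of c q p "hd as" "tl as"] less_papp[of p "hd as"]
  by (cases as) (auto simp del: less_papp intro: less_le_trans)

text \<open>Hands a bound on a form down to its factors, so that induction hypotheses with such a
  bound apply to them. The first factor of a whole form has no bound and is not covered.\<close>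

lemma prenorm_elem_less:
  "prenorm c (Some q) p as \<Longrightarrow> q < p \<Longrightarrow> a \<in> set as \<Longrightarrow> a < pvalue c p as"
proof (induction as arbitrary: q p)
  case (Cons b as)
  have b: "b \<le> q" using prenorm_hd[OF Cons.prems(1)] by simp
  have less: "p < pvalue c p (b # as)" using less_pvalue[OF Cons.prems(1)] .
  show ?case
  proof (cases "a = b")
    case True
    then show ?thesis using b less Cons.prems(2) by order
  next
    case False
    then have a: "a \<in> set as" using Cons.prems(3) by simp
    then have ne: "as \<noteq> []" by auto
    then have "prenorm c (Some p) (p \<cdot>\<^sub>P b) as" using Cons.prems(1) by (simp add: prenorm_Cons)
    from Cons.IH[OF this _ a] show ?thesis using ne by (simp add: pvalue_Cons)
  qed
qed simp

text \<open>The parameter \<open>B\<close> restricts the atoms. It allows one set to be described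
  over different bases: with the single atom \<open>gen\<close> at the start, with atoms from the
  set itself afterwards.\<close>

inductive divform :: "P \<Rightarrow> (P \<Rightarrow> bool) \<Rightarrow> P \<Rightarrow> bool" for b B where
  atom: "a \<le> b \<Longrightarrow> B a \<Longrightarrow> divform b B a"
| seq: "(\<forall>a\<in>set as. divform b B a) \<Longrightarrow> prenorm c None b as \<Longrightarrow> divform b B (pvalue c b as)"

inductive state :: "P \<Rightarrow> (P \<Rightarrow> bool) \<Rightarrow> P option \<Rightarrow> P \<Rightarrow> bool" for b B where
  init: "state b B None b"
| step: "state b B q p \<Longrightarrow> divform b B a \<Longrightarrow> le_opt a q \<Longrightarrow> state b B (Some p) (p \<cdot>\<^sub>P a)"

lemma state_divform:
  "state b B q p \<Longrightarrow> \<forall>a\<in>set as. divform b B a \<Longrightarrow> prenorm c q p as \<Longrightarrow> divform b B (pvalue c p as)"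
proof (induction arbitrary: as rule: state.induct)
  case init
  then show ?case by (intro divform.seq)
next
  case (step q p a)
  then have "as \<noteq> []" by auto
  then show ?case
    using step.IH[of "a # as"] step.hyps step.prems by (simp add: pvalue_Cons prenorm_Cons)
qed

lemma state_papp: "state b B q p \<Longrightarrow> divform b B a \<Longrightarrow> le_opt a q \<Longrightarrow> divform b B (p \<cdot>\<^sub>P a)"
  using state_divform[of b B q p "[a]" Dot] by simp

text \<open>The strictness condition for \<^const>\<open>Circ\<close> can be relaxed because of \<open>p a \<circ> p = p \<circ> a\<close>.\<close>

lemma state_pcomp: "state b B q p \<Longrightarrow> divform b B a \<Longrightarrow> le_opt a q \<Longrightarrow> divform b B (p \<circ>\<^sub>P a)"
proof (induction arbitrary: a rule: state.induct)
  case init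
  then show ?case using state_divform[OF state.init, of "[a]" b B Circ] by simp
next
  case (step q p a')
  show ?case
  proof (cases "a = p")
    case True
    then show ?thesis using step.IH[OF step.hyps(2,3)] by (simp flip: pcomp_eq)
  next
    case False
    then have "a < p" using step.prems by simp
    then show ?thesis
      using state_divform[OF state.step[OF step.hyps], of "[a]" Circ] step.prems by simp
  qed
qed

lemma state_less: "state b B (Some q) p \<Longrightarrow> q < p"
  by (cases rule: state.cases) auto

lemma state_Some: "state b B (Some q) p \<Longrightarrow> divform b B p"
  by (cases rule: state.cases) (auto intro: state_papp)

lemma state_ge: "state b B q p \<Longrightarrow> b \<le> p"
proof (induction rule: state.induct)
  case (step q p a)
  then show ?case using less_papp[of p a] by order
qed simp

text \<open>An element strictly inside the interval that belongs to a prefix has this prefix: its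
  factors are forced one after the other, since different factors lead to disjoint
  intervals.\<close>

lemma state_extends:
  assumes lin: "\<And>p q. divform b B p \<Longrightarrow> divform b B q \<Longrightarrow> comparable p q"
  shows "state b B q p \<Longrightarrow> \<forall>a\<in>set as. divform b B a \<Longrightarrow> prenorm c None b as \<Longrightarrow>
    p < pvalue c b as \<Longrightarrow> (\<forall>w. q = Some w \<longrightarrow> pvalue c b as < p \<circ>\<^sub>P w) \<Longrightarrow>
    \<exists>as'. prenorm c q p as' \<and> pvalue c p as' = pvalue c b as \<and> set as' \<subseteq> set as"
proof (induction rule: state.induct)
  case init
  then show ?case by blast
next
  case (step q p a)
  let ?v = "pvalue c b as"
  have v: "p \<cdot>\<^sub>P a < ?v" "?v < p \<circ>\<^sub>P a" using step.prems by (auto simp: pcomp_eq[of p a])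
  have "p < ?v" using v(1) less_papp[of p a] by order
  moreover have "?v < p \<circ>\<^sub>P w" if "q = Some w" for w
    using v(2) pcomp_mono[of a w p] that step.hyps(3) by auto
  ultimately obtain as' where as': "prenorm c q p as'" "pvalue c p as' = ?v" "set as' \<subseteq> set as"
    using step by blast
  then obtain d ds where ds: "as' = d # ds" by (cases as') auto
  then have d: "p \<cdot>\<^sub>P d \<le> ?v" "?v \<le> p \<circ>\<^sub>P d" using as' pvalue_bounds by metis+
  have "comparable d a" using lin step.hyps(2) step.prems(1) as'(3) ds by auto
  moreover have "\<not> d < a" using pcomp_less_papp[of d a p] d v by (meson less_le_not_le order.trans)
  moreover have "\<not> a < d" using pcomp_less_papp[of a d p] d v by (meson less_le_not_le order.trans)
  ultimately have "d = a" by (auto simp: comparable_def)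
  moreover have "ds \<noteq> []"
    using as'(2) v \<open>d = a\<close> unfolding ds by (cases c; cases ds) auto
  ultimately show ?case
    using as' ds by (intro exI[of _ ds]) (auto simp: prenorm_Cons pvalue_Cons)
qed

text \<open>Up to \<open>n\<close> further factors from \<open>D\<close>, the first one bounded by \<open>q\<close>, lead from \<open>p\<close> to elements of \<open>D\<close>.
  The number \<open>n\<close> is the induction parameter of \<open>extendible_left_mult\<close>.\<close>

primrec extendible :: "(P \<Rightarrow> bool) \<Rightarrow> nat \<Rightarrow> P option \<Rightarrow> P \<Rightarrow> bool" where
  "extendible D 0 q p \<longleftrightarrow> D p"
| "extendible D (Suc n) q p \<longleftrightarrow> D p \<and>
    (\<forall>a. D a \<longrightarrow> le_opt a q \<longrightarrow> D (p \<circ>\<^sub>P a) \<and> extendible D n (Some p) (p \<cdot>\<^sub>P a))"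

lemma extendible_D: "extendible D n q p \<Longrightarrow> D p"
  by (cases n) auto

lemma extendible_antimono:
  "extendible D n q p \<Longrightarrow> (\<And>a. le_opt a q' \<Longrightarrow> le_opt a q) \<Longrightarrow> extendible D n q' p"
  by (cases n) auto

lemma state_extendible:
  "state b B q p \<Longrightarrow> divform b B p \<Longrightarrow> extendible (divform b B) n q p"
proof (induction n arbitrary: q p)
  case (Suc n)
  then show ?case using state_pcomp state_papp state.step by auto
qed simp

text \<open>By left distributivity, multiplying by x from the left multiplies every factor, and the
  bounds survive by monotonicity. A final \<circ> is split off and left to the caller, who needs the
  bound for x \<circ> h and not just for x h.\<close>

lemma prenorm_map_state:
  assumes "prenorm c (Some q) p as" "state b B (Some v) (x \<cdot>\<^sub>P p)"
    "\<And>a. a < q \<Longrightarrow> x \<circ>\<^sub>P a \<le> v" "x \<cdot>\<^sub>P q \<le> v" "\<forall>a\<in>set as. divform b B (x \<cdot>\<^sub>P a)"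
  shows "\<exists>v'. v \<le> v' \<and> (case c of
      Dot \<Rightarrow> state b B (Some v') (x \<cdot>\<^sub>P pvalue c p as)
    | Circ \<Rightarrow> \<exists>f h. pvalue c p as = f \<circ>\<^sub>P h \<and> h \<in> set as \<and> state b B (Some v') (x \<cdot>\<^sub>P f) \<and> x \<circ>\<^sub>P h \<le> v')"
  using assms
proof (induction as arbitrary: q p v)
  case (Cons a as)
  have "a \<le> q" using prenorm_hd[OF Cons.prems(1)] by simp
  then have "x \<cdot>\<^sub>P a \<le> v"
    using Cons.prems(3)[of a] Cons.prems(4) papp_less_pcomp[of x a] by (cases "a = q") (auto intro: order_trans less_imp_le)
  then have st: "state b B (Some (x \<cdot>\<^sub>P p)) (x \<cdot>\<^sub>P (p \<cdot>\<^sub>P a))"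
    using state.step[OF Cons.prems(2), of "x \<cdot>\<^sub>P a"] Cons.prems(5) by (simp add: papp_distrib[of x p a])
  have v: "v < x \<cdot>\<^sub>P p" using state_less[OF Cons.prems(2)] .
  show ?case
  proof (cases "as = []")
    case True
    show ?thesis
    proof (cases c)
      case Dot
      then show ?thesis using True v st by (intro exI[of _ "x \<cdot>\<^sub>P p"]) simp
    next
      case Circ
      have "a < q" using Cons.prems(1) by (simp add: True Circ)
      then show ?thesis
        using Cons.prems(2,3) by (intro exI[of _ v]) (auto simp: True Circ)
    qed
  next
    case False
    then have "prenorm c (Some p) (p \<cdot>\<^sub>P a) as" using Cons.prems(1) by (simp add: prenorm_Cons)
    moreover have "x \<circ>\<^sub>P e \<le> x \<cdot>\<^sub>P p" if "e < p" for e
      using pcomp_less_papp[OF that] by (simp add: less_imp_le)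
    ultimately obtain v' where v': "x \<cdot>\<^sub>P p \<le> v'" and r: "case c of
        Dot \<Rightarrow> state b B (Some v') (x \<cdot>\<^sub>P pvalue c (p \<cdot>\<^sub>P a) as)
      | Circ \<Rightarrow> \<exists>f h. pvalue c (p \<cdot>\<^sub>P a) as = f \<circ>\<^sub>P h \<and> h \<in> set as \<and> state b B (Some v') (x \<cdot>\<^sub>P f) \<and> x \<circ>\<^sub>P h \<le> v'"
      using Cons.IH[OF _ st, of "p"] Cons.prems(5) by fastforce
    have "v \<le> v'" using v v' by order
    with r show ?thesis
      using False by (intro exI[of _ v']) (auto simp: pvalue_Cons split: opsym.splits)
  qed
qed simp

text \<open>Makes p \<circ> h an admissible next factor after a prefix with bound \<open>r\<close>,
  for every h up to \<open>q\<close>. The strict inequality keeps everything up to that prefix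
  composed with q' strictly inside the interval that \<open>state_extends\<close> requires.\<close>

definition fits :: "P option \<Rightarrow> P option \<Rightarrow> P \<Rightarrow> bool" where
  "fits r q p \<longleftrightarrow> (\<forall>w. r = Some w \<longrightarrow> (\<exists>q'. q = Some q' \<and> q' < w \<and> p \<circ>\<^sub>P q' \<le> w))"

text \<open>An outer induction on \<open>n\<close>, for all prefixes and right factors at once, and
  inside it an induction on the division form of the factor \<open>a\<close> that is to follow w p.
  If \<open>a\<close> exceeds w, it starts with w h for some h within the bound \<open>q\<close>,
  and the cases differ in what comes after h.\<close>

lemma extendible_left_mult:
  assumes lin: "\<And>p q. divform b B p \<Longrightarrow> divform b B q \<Longrightarrow> comparable p q"
    and b: "divform b B b"
  shows "state b B r w \<Longrightarrow> extendible (divform b B) n q p \<Longrightarrow> fits r q p \<Longrightarrow> (\<forall>q'. q = Some q' \<longrightarrow> divform b B q') \<Longrightarrow>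
    extendible (divform b B) n (map_option (\<lambda>q. w \<circ>\<^sub>P q) q) (w \<cdot>\<^sub>P p)"
proof (induction n arbitrary: r w q p rule: less_induct)
  case (less n)
  let ?D = "divform b B" and ?x = "w \<cdot>\<^sub>P p"
  have Dp: "?D p" using extendible_D[OF less.prems(2)] .
  have Dw: "?D w" using less.prems(1) b state_Some by (cases rule: state.cases) (auto intro: state_papp)
  have fit: "le_opt (p \<circ>\<^sub>P h) r" "le_opt (p \<cdot>\<^sub>P h) r" if "le_opt h q" for h
  proof -
    show "le_opt (p \<circ>\<^sub>P h) r"
      using less.prems(3) that unfolding fits_def by (cases r) (auto intro: order_trans[OF pcomp_mono])
    then show "le_opt (p \<cdot>\<^sub>P h) r"
      using papp_less_pcomp[of p h] le_opt_trans less_imp_le by blast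
  qed
  have "le_opt p r"
    using less.prems(3) unfolding fits_def
    by (cases r) (auto intro: order_trans[OF less_imp_le[OF less_pcomp]])
  then have st: "state b B (Some w) ?x" and Dx: "?D ?x"
    using state.step[OF less.prems(1) Dp] state_papp[OF less.prems(1) Dp] by auto
  show ?case
  proof (cases n)
    case 0
    then show ?thesis using Dx by simp
  next
    case (Suc m)
    define good where "good a \<longleftrightarrow> ?D (?x \<circ>\<^sub>P a) \<and> extendible ?D m (Some ?x) (?x \<cdot>\<^sub>P a)" for a
    have H: "?D (p \<circ>\<^sub>P h)" "extendible ?D m (Some p) (p \<cdot>\<^sub>P h)" if "?D h" "le_opt h q" for h
      using less.prems(2) that unfolding Suc by auto
    have stG: "state b B (Some w) (w \<cdot>\<^sub>P (p \<circ>\<^sub>P h))" if "?D h" "le_opt h q" for h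
      using state.step[OF less.prems(1)] H(1) fit that by blast
    have xh: "?x \<circ>\<^sub>P (w \<cdot>\<^sub>P h) = w \<cdot>\<^sub>P (p \<circ>\<^sub>P h)" for h
      by (simp add: papp_comp)
    \<comment> \<open>Right factor w h: (w p)(w h) = w (p h), and p h is extendible by one step less
      than p, so the outer hypothesis applies.\<close>
    have goodB: "good (w \<cdot>\<^sub>P h)" if h: "?D h" "le_opt h q" for h
    proof -
      have "fits r (Some p) (p \<cdot>\<^sub>P h)"
        using fit(1)[OF h(2)] unfolding fits_def
        by (auto intro: less_le_trans[OF less_pcomp] simp flip: pcomp_eq)
      then have "extendible ?D m (Some (w \<circ>\<^sub>P p)) (w \<cdot>\<^sub>P (p \<cdot>\<^sub>P h))"
        using less.IH[OF _ less.prems(1) H(2)[OF h]] Dp Suc by simp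
      then have "extendible ?D m (Some ?x) (w \<cdot>\<^sub>P (p \<cdot>\<^sub>P h))"
        using papp_less_pcomp[of w p] by (elim extendible_antimono) (auto intro: order_trans less_imp_le)
      then show ?thesis
        unfolding good_def xh using state_Some[OF stG[OF h]] by (simp add: papp_distrib[of w p h])
    qed
    \<comment> \<open>Right factor f \<circ> h: with y = x f and z = x h one has (y \<circ> z) a = y
      (z a). So y becomes the prefix and z a the right factor, which is why the outer hypothesis
      must hold for arbitrary prefixes.\<close>
    have goodC: "good (f \<circ>\<^sub>P h)" if f: "state b B (Some v) (?x \<cdot>\<^sub>P f)" and h: "good h" "?x \<circ>\<^sub>P h \<le> v" for f h v
    proof -
      let ?y = "?x \<cdot>\<^sub>P f" and ?z = "?x \<cdot>\<^sub>P h"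
      have Dz: "?D ?z" using h(1) extendible_D unfolding good_def by blast
      have z: "?z < ?x \<circ>\<^sub>P h" by (rule papp_less_pcomp)
      have "?x \<circ>\<^sub>P (f \<circ>\<^sub>P h) = ?y \<circ>\<^sub>P (?x \<circ>\<^sub>P h)"
        by (metis pcomp_assoc pcomp_eq)
      then have 1: "?D (?x \<circ>\<^sub>P (f \<circ>\<^sub>P h))"
        using state_pcomp[OF f] h unfolding good_def by simp
      have eq: "?x \<cdot>\<^sub>P (f \<circ>\<^sub>P h) = ?y \<circ>\<^sub>P ?z" by (rule papp_comp)
      have Dyz: "?D (?y \<circ>\<^sub>P ?z)"
        using state_pcomp[OF f Dz] z h(2) by simp
      have "extendible ?D m (Some ?x) (?y \<circ>\<^sub>P ?z)"
      proof (cases m)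
        case 0
        then show ?thesis using Dyz by simp
      next
        case (Suc k)
        have "?D (?y \<circ>\<^sub>P ?z \<circ>\<^sub>P a) \<and> extendible ?D k (Some (?y \<circ>\<^sub>P ?z)) ((?y \<circ>\<^sub>P ?z) \<cdot>\<^sub>P a)"
          if a: "?D a" "a \<le> ?x" for a
        proof -
          have za: "?D (?z \<circ>\<^sub>P a)" "extendible ?D k (Some ?z) (?z \<cdot>\<^sub>P a)"
            using h(1) a unfolding good_def Suc by auto
          have "?z \<circ>\<^sub>P a \<le> ?z \<circ>\<^sub>P ?x" using pcomp_mono[OF a(2)] .
          then have le: "?z \<circ>\<^sub>P a \<le> v" using h(2) pcomp_eq[of ?x h] by simp
            have "?z < v" using le less_pcomp[of ?z a] by order
            moreover have "?z \<cdot>\<^sub>P a \<circ>\<^sub>P ?z \<le> v" using le pcomp_eq[of ?z a] by simp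
            ultimately have "fits (Some v) (Some ?z) (?z \<cdot>\<^sub>P a)"
              unfolding fits_def by blast
          then have "extendible ?D k (Some (?y \<circ>\<^sub>P ?z)) (?y \<cdot>\<^sub>P (?z \<cdot>\<^sub>P a))"
            using less.IH[OF _ f za(2)] Dz Suc \<open>n = Suc m\<close> by simp
          moreover have "?D (?y \<circ>\<^sub>P (?z \<circ>\<^sub>P a))" using state_pcomp[OF f za(1)] le by simp
          ultimately show ?thesis by (simp add: comp_papp pcomp_assoc)
        qed
        then show ?thesis using Dyz Suc by simp
      qed
      then show ?thesis using 1 unfolding good_def eq by simp
    qed
    have "good a" if "?D a" "le_opt a (map_option (\<lambda>q. w \<circ>\<^sub>P q) q)" for a
      using that
    proof (induction rule: divform.induct)
      case (atom a)
      then have "?D a" by (auto intro: divform.atom)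
      moreover have "a \<le> w" using atom state_ge[OF less.prems(1)] by order
      ultimately show ?case
        using state_pcomp[OF st, of a] state.step[OF st, of a] state_papp[OF st, of a]
        unfolding good_def by (auto intro: state_extendible)
    next
      case (seq as c)
      let ?a = "pvalue c b as"
      have Da: "?D ?a" using divform.seq[of as b B c] seq by blast
      show ?case
      proof (cases "w < ?a")
        case False
        then have "?a \<le> w" using lin[OF Da Dw] by (auto simp: comparable_def)
        then show ?thesis
          using Da state_pcomp[OF st, of ?a] state.step[OF st, of ?a] state_papp[OF st, of ?a]
          unfolding good_def by (auto intro: state_extendible)
      next
        case True
        have "?a < w \<circ>\<^sub>P v" if "r = Some v" for v
          using seq.prems less.prems(3) that pcomp_mono_strict[of _ v w] unfolding fits_def by fastforce
        then obtain gs where gs: "prenorm c r w gs" "pvalue c w gs = ?a" "set gs \<subseteq> set as"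
          using state_extends[OF lin less.prems(1)] seq True by blast
        then obtain h hs where hs: "gs = h # hs" by (cases gs) auto
        have Dg: "?D g" if "g \<in> set gs" for g using gs(3) seq.IH that by blast
        then have Dh: "?D h" by (simp add: hs)
        have h: "w \<cdot>\<^sub>P h \<le> ?a" using pvalue_bounds[of c r w h hs] gs(1,2) by (simp add: hs)
        have hq: "le_opt h q"
        proof (cases q)
          case (Some q')
          then have "?a \<le> w \<circ>\<^sub>P q'" using seq.prems by simp
          then have "\<not> q' < h" using h pcomp_less_papp[of q' h w] by (meson leD order_trans)
          then show ?thesis using lin[OF Dh, of q'] less.prems(4) Some by (auto simp: comparable_def)
        qed simp
        let ?g = "w \<cdot>\<^sub>P (p \<circ>\<^sub>P h)"
        have xg: "?x < ?g" by (rule papp_mono_strict) simp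
        note stg = stG[OF Dh hq]
        \<comment> \<open>Treated as w h \<circ> h' = (w h h') \<circ> (w h), to which
          \<open>goodC\<close> applies. The choice h' = w covers w \<circ> h = w h \<circ>
          w.\<close>
        have circ1: "good (w \<cdot>\<^sub>P h \<circ>\<^sub>P h')" if "?D h'" "h' \<le> w" for h'
        proof -
          have "?x \<cdot>\<^sub>P (w \<cdot>\<^sub>P h \<cdot>\<^sub>P h') = ?g \<cdot>\<^sub>P h'"
            by (simp add: xh flip: comp_papp)
          then have "state b B (Some ?g) (?x \<cdot>\<^sub>P (w \<cdot>\<^sub>P h \<cdot>\<^sub>P h'))"
            using state.step[OF stg that(1)] that(2) by simp
          from goodC[OF this goodB[OF Dh hq]] show ?thesis
            by (simp add: xh flip: pcomp_eq)
        qed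
        show ?thesis
        proof (cases hs)
          case Nil
          then show ?thesis
            using gs(2) goodB[OF Dh hq] circ1[OF Dw] by (cases c) (auto simp: hs simp flip: pcomp_eq)
        next
          case (Cons h' hs')
          have h': "h' \<le> w" and Dh': "?D h'"
            using gs(1) prenorm_hd[of c "Some w" "w \<cdot>\<^sub>P h" h' hs'] Dg by (auto simp: hs Cons)
          have st': "state b B (Some ?g) (?x \<cdot>\<^sub>P (w \<cdot>\<^sub>P h \<cdot>\<^sub>P h'))"
            using state.step[OF stg Dh'] h' by (simp add: xh flip: comp_papp)
          have fin: "good ?a" if v: "state b B (Some v) (?x \<cdot>\<^sub>P ?a)" "?g \<le> v" for v
          proof -
            have xv: "?x \<le> v" using xg v(2) by order
            have D: "?D (?x \<cdot>\<^sub>P ?a)" using state_Some[OF v(1)] .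
            have "extendible ?D m (Some ?x) (?x \<cdot>\<^sub>P ?a)"
              using xv by (intro extendible_antimono[OF state_extendible[OF v(1) D]]) (auto intro: order_trans)
            moreover have "?D (?x \<circ>\<^sub>P ?a)"
              using state_pcomp[OF v(1) Dx] xv by (simp flip: pcomp_eq)
            ultimately show ?thesis unfolding good_def by simp
          qed
          show ?thesis
          proof (cases "hs' = []")
            case True
            then show ?thesis
              using gs(1,2) circ1[OF Dh' h'] fin[of ?g] st' by (cases c) (auto simp: hs Cons)
          next
            case False
            have pn: "prenorm c (Some (w \<cdot>\<^sub>P h)) (w \<cdot>\<^sub>P h \<cdot>\<^sub>P h') hs'"
              using gs(1) False by (auto simp: hs Cons prenorm_Cons)
            have a: "?a = pvalue c (w \<cdot>\<^sub>P h \<cdot>\<^sub>P h') hs'"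
              using gs(2) False by (simp add: hs Cons pvalue_Cons)
            have goodg: "good g" if g: "g \<in> set hs'" for g
            proof -
              have "g < ?a" using prenorm_elem_less[OF pn _ g] a by simp
              then have "le_opt g (map_option (\<lambda>q. w \<circ>\<^sub>P q) q)"
                using seq.prems by (meson le_opt_trans less_imp_le)
              then show ?thesis using seq.IH gs(3) g by (auto simp: hs Cons)
            qed
            have "x \<circ>\<^sub>P e \<le> ?g" if "e < w \<cdot>\<^sub>P h" "x = ?x" for e x
              using pcomp_mono_strict[OF that(1), of ?x] that(2) by (simp add: xh)
            moreover have "?x \<cdot>\<^sub>P (w \<cdot>\<^sub>P h) \<le> ?g"
              using papp_less_pcomp[of ?x "w \<cdot>\<^sub>P h"] by (simp add: xh)
            moreover have "\<forall>g\<in>set hs'. ?D (?x \<cdot>\<^sub>P g)"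
              using goodg extendible_D unfolding good_def by blast
            ultimately obtain v where v: "?g \<le> v" and r: "case c of
                Dot \<Rightarrow> state b B (Some v) (?x \<cdot>\<^sub>P ?a)
              | Circ \<Rightarrow> \<exists>f e. ?a = f \<circ>\<^sub>P e \<and> e \<in> set hs' \<and> state b B (Some v) (?x \<cdot>\<^sub>P f) \<and> ?x \<circ>\<^sub>P e \<le> v"
              using prenorm_map_state[OF pn st'] unfolding a by blast
            show ?thesis
            proof (cases c)
              case Dot
              then show ?thesis using r v fin by simp
            next
              case Circ
              then show ?thesis using r goodg goodC by auto
            qed
          qed
        qed
      qed
    qed
    then show ?thesis using Dx unfolding good_def Suc by simp
  qed
qed

section \<open>Change of base\<close>

text \<open>The first differing factors decide, through disjoint intervals. If one product stops
  while the other goes on, it is an endpoint of the interval that contains the other.\<close>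

lemma comparable_pvalue:
  "prenorm c q p as \<Longrightarrow> prenorm c' q p as' \<Longrightarrow> \<forall>a\<in>set as. \<forall>a'\<in>set as'. comparable a a' \<Longrightarrow>
    comparable (pvalue c p as) (pvalue c' p as')"
proof (induction as arbitrary: q p as')
  case (Cons a as)
  then obtain d ds where ds: "as' = d # ds" by (cases as') auto
  note v = pvalue_bounds[OF Cons.prems(1)] pvalue_bounds[OF Cons.prems(2)[unfolded ds]]
  consider "a < d" | "d < a" | "a = d" using Cons.prems(3) by (auto simp: ds comparable_def)
  then show ?case
  proof cases
    case 1
    with v pcomp_less_papp[of a d p] show ?thesis
      unfolding ds comparable_def by (meson le_less_trans less_le_trans)
  next
    case 2
    with v pcomp_less_papp[of d a p] show ?thesis
      unfolding ds comparable_def by (meson le_less_trans less_le_trans)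
  next
    case 3
    show ?thesis
    proof (cases "as = [] \<or> ds = []")
      case True
      then have "pvalue c p (a # as) \<in> {p \<cdot>\<^sub>P a, p \<circ>\<^sub>P a} \<or> pvalue c' p (d # ds) \<in> {p \<cdot>\<^sub>P a, p \<circ>\<^sub>P a}"
        using 3 by (cases c; cases c') auto
      then have "pvalue c p (a # as) \<le> pvalue c' p (d # ds) \<or> pvalue c' p (d # ds) \<le> pvalue c p (a # as)"
        using v 3 by (elim disjE insertE emptyE) simp_all
      then show ?thesis
        unfolding ds comparable_def by (metis order.order_iff_strict)
    next
      case False
      then show ?thesis
        using Cons.IH[of "Some p" "p \<cdot>\<^sub>P a" ds] Cons.prems 3 by (simp add: ds prenorm_Cons pvalue_Cons)
    qed
  qed
qed simp

text \<open>For a form a with first factor d, induction gives d < b d \<le> a, and then a \<le> b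
  \<circ> d < b a.\<close>

lemma less_papp_self: "divform b B a \<Longrightarrow> a < b \<cdot>\<^sub>P a"
proof (induction rule: divform.induct)
  case (atom a)
  then show ?case using less_papp[of b a] by order
next
  case (seq as c)
  then obtain d ds where ds: "as = d # ds" by (cases as) auto
  note v = pvalue_bounds[OF seq.hyps[unfolded ds]]
  have "d < pvalue c b as" using seq v by (auto simp: ds)
  then show ?case using v pcomp_less_papp[of d _ b] unfolding ds by (meson le_less_trans)
qed

lemma extendible_pvalue:
  "(\<And>n. extendible D n q p) \<Longrightarrow> \<forall>a\<in>set as. D a \<Longrightarrow> prenorm c q p as \<Longrightarrow> D (pvalue c p as)"
proof (induction as arbitrary: q p)
  case (Cons a as)
  have a: "D (p \<circ>\<^sub>P a)" "extendible D n (Some p) (p \<cdot>\<^sub>P a)" for n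
    using Cons.prems(1)[of "Suc n"] Cons.prems(2) prenorm_hd[OF Cons.prems(3)] by auto
  show ?case
  proof (cases "as = []")
    case True
    then show ?thesis using a extendible_D[OF a(2)] by (cases c) auto
  next
    case False
    then show ?thesis using Cons.IH[OF a(2)] Cons.prems by (simp add: prenorm_Cons pvalue_Cons)
  qed
qed simp

text \<open>This says that \<open>D\<close> is the set of values of \<open>u\<close>-division forms with atoms from \<open>D\<close>, see
  \<open>divides_divform\<close>.\<close>

definition divides :: "(P \<Rightarrow> bool) \<Rightarrow> P \<Rightarrow> bool" where
  "divides D u \<longleftrightarrow> (\<forall>n. extendible D n None u) \<and> (\<forall>a. D a \<longrightarrow> divform u D a)"

lemma divform_closed:
  assumes "\<And>n. extendible D n None u" "divform u D a"
  shows "D a"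
  using assms(2)
proof (induction rule: divform.induct)
  case (seq as c)
  then show ?case using extendible_pvalue[OF assms(1)] by blast
qed

lemma divides_divform: "divides D u \<Longrightarrow> divform u D = D"
  unfolding divides_def using divform_closed by blast

lemma divides_D: "divides D u \<Longrightarrow> D u"
  unfolding divides_def using extendible_D by blast

lemma divides_left_mult:
  assumes "\<And>p q. D p \<Longrightarrow> D q \<Longrightarrow> comparable p q" "divides D b"
    "extendible D n q p" "\<forall>q'. q = Some q' \<longrightarrow> D q'"
  shows "extendible D n (map_option (\<lambda>q. b \<circ>\<^sub>P q) q) (b \<cdot>\<^sub>P p)"
  using extendible_left_mult[of b D None b n q p] assms divides_D[OF assms(2)]
  by (simp add: divides_divform state.init fits_def)

text \<open>Continuing p within the bound q never leads above p \<circ> q, since (p a) \<circ> p = p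
  \<circ> a \<le> p \<circ> q. Elements of \<open>D\<close> below t are atoms over t.\<close>

lemma extendible_divform_le:
  assumes "\<And>a. divform t D a \<Longrightarrow> D a"
  shows "extendible D n (Some q) p \<Longrightarrow> p \<circ>\<^sub>P q \<le> t \<Longrightarrow> extendible (divform t D) n (Some q) p"
proof (induction n arbitrary: q p)
  case 0
  then have "p \<le> t" using less_pcomp[of p q] by order
  then show ?case using 0 by (auto intro: divform.atom)
next
  case (Suc n)
  have le: "p \<le> t" using Suc.prems(2) less_pcomp[of p q] by order
  have "divform t D (p \<circ>\<^sub>P a)" "extendible (divform t D) n (Some p) (p \<cdot>\<^sub>P a)" if "divform t D a" "a \<le> q" for a
  proof -
    have pa: "p \<circ>\<^sub>P a \<le> t" using pcomp_mono[OF that(2), of p] Suc.prems(2) by order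
    have "D a" using assms that by blast
    with Suc.prems that have "D (p \<circ>\<^sub>P a)" "extendible D n (Some p) (p \<cdot>\<^sub>P a)" by auto
    then show "divform t D (p \<circ>\<^sub>P a)" "extendible (divform t D) n (Some p) (p \<cdot>\<^sub>P a)"
      using pa Suc.IH by (auto intro: divform.atom simp flip: pcomp_eq)
  qed
  then show ?case using le Suc.prems(1) by (auto intro: divform.atom)
qed

text \<open>Shared by t = b s and t = b \<circ> s, the two ways to build a new base. By
  \<open>ext\<close>, forms over t have values in \<open>D\<close>, so the inclusion of
  \<open>D\<close> in D' remains. The last two assumptions let \<open>prenorm_map_state\<close>
  start with the bound t when an s-form is multiplied by b.\<close>

locale division_step =
  fixes D :: "P \<Rightarrow> bool" and b s t :: P
  assumes lin: "\<And>p q. D p \<Longrightarrow> D q \<Longrightarrow> comparable p q"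
    and b: "divides D b" and s: "divides D s"
    and ext: "\<And>n. extendible D n None t"
    and bs_t: "b \<cdot>\<^sub>P s \<le> t" and less_s: "\<And>a. a < s \<Longrightarrow> b \<circ>\<^sub>P a \<le> t"
begin

abbreviation "D' \<equiv> divform t D"

text \<open>Allows every b-form with first factor \<open>f\<close> to be rewritten over t, provided
  its later factors can be; see \<open>good_D'_pvalue\<close>.\<close>

definition "good f \<longleftrightarrow> (\<forall>n. extendible D' n (Some b) (b \<cdot>\<^sub>P f)) \<and> D' (b \<circ>\<^sub>P f)"

lemma b_less_t: "b < t"
  using bs_t less_papp[of b s] by order

lemma D'_D: "D' a \<Longrightarrow> D a"
  using divform_closed ext by blast

lemma D'_t: "D' t" and D'_b: "D' b"
  using extendible_D[OF ext] divides_D[OF b] b_less_t by (auto intro: divform.atom)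

lemma D'_le: "D a \<Longrightarrow> a \<le> b \<Longrightarrow> D' a"
  using b_less_t by (intro divform.atom) order

lemma good_D': "good f \<Longrightarrow> D' (b \<cdot>\<^sub>P f)"
  unfolding good_def using extendible_D by blast

lemma good_state:
  assumes st: "state t D q (b \<cdot>\<^sub>P f)" and q: "le_opt b q" and D': "D' (b \<cdot>\<^sub>P f)"
  shows "good f"
proof -
  have "extendible D' n (Some b) (b \<cdot>\<^sub>P f)" for n
    by (rule extendible_antimono[OF state_extendible[OF st D']]) (use q in \<open>auto elim: le_opt_trans[rotated]\<close>)
  moreover have "D' (b \<circ>\<^sub>P f)"
    using state_pcomp[OF st D'_b q] by (simp flip: pcomp_eq)
  ultimately show ?thesis unfolding good_def by blast
qed

lemma good_le:
  assumes "D f" "b \<circ>\<^sub>P f \<le> t"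
  shows "good f"
proof -
  have "extendible D (Suc n) None b" for n using b unfolding divides_def by blast
  then have "D (b \<circ>\<^sub>P f)" "extendible D n (Some b) (b \<cdot>\<^sub>P f)" for n
    using assms(1) by auto
  then show ?thesis
    unfolding good_def using assms(2) D'_D
    by (auto intro: divform.atom extendible_divform_le simp flip: pcomp_eq)
qed

text \<open>As in \<open>goodC\<close> of \<open>extendible_left_mult\<close>: (y \<circ> z) a = y
  (z a) with z = b h. The hypothesis speaks of the product b f so that f = s \<circ> a can be split
  in two ways: as it stands when t = b s, and as s a \<circ> s when t = b \<circ> s.\<close>

lemma good_comp:
  assumes st: "state t D r y" and h: "good h" and r: "le_opt (b \<circ>\<^sub>P h) r"
    and f: "b \<cdot>\<^sub>P f = y \<circ>\<^sub>P (b \<cdot>\<^sub>P h)"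
  shows "good f"
proof -
  let ?z = "b \<cdot>\<^sub>P h"
  have Dz: "D' ?z" using good_D'[OF h] .
  have z: "le_opt ?z r" using r papp_less_pcomp[of b h] le_opt_trans less_imp_le by blast
  have "extendible D' n (Some b) (y \<circ>\<^sub>P ?z)" for n
  proof (cases n)
    case 0
    then show ?thesis using state_pcomp[OF st Dz z] by simp
  next
    case (Suc m)
    have "D' (y \<circ>\<^sub>P ?z \<circ>\<^sub>P a) \<and> extendible D' m (Some (y \<circ>\<^sub>P ?z)) ((y \<circ>\<^sub>P ?z) \<cdot>\<^sub>P a)"
      if a: "D' a" "a \<le> b" for a
    proof -
      have "extendible D' (Suc m) (Some b) ?z" using h unfolding good_def by blast
      then have za: "D' (?z \<circ>\<^sub>P a)" "extendible D' m (Some ?z) (?z \<cdot>\<^sub>P a)" using a by auto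
      have "?z \<circ>\<^sub>P a \<le> b \<circ>\<^sub>P h" unfolding pcomp_eq[of b h] using pcomp_mono[OF a(2)] .
      then have le: "le_opt (?z \<circ>\<^sub>P a) r" using r le_opt_trans by blast
      have "fits r (Some ?z) (?z \<cdot>\<^sub>P a)"
        unfolding fits_def
      proof (intro allI impI exI conjI)
        fix w assume "r = Some w"
        then have "?z \<circ>\<^sub>P a \<le> w" using le by simp
        then show "?z < w" "?z \<cdot>\<^sub>P a \<circ>\<^sub>P ?z \<le> w"
          using less_pcomp[of ?z a] pcomp_eq[of ?z a] by (order, simp)
      qed simp
      then have "extendible D' m (map_option (\<lambda>q. y \<circ>\<^sub>P q) (Some ?z)) (y \<cdot>\<^sub>P (?z \<cdot>\<^sub>P a))"
        using lin D'_D D'_t Dz za(2) by (intro extendible_left_mult[OF _ _ st]) auto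
      then show ?thesis
        using state_pcomp[OF st za(1) le] by (simp add: comp_papp pcomp_assoc)
    qed
    then show ?thesis using state_pcomp[OF st Dz z] Suc by simp
  qed
  moreover have "D' (b \<circ>\<^sub>P f)"
  proof -
    have "extendible D' (Suc 0) (Some b) ?z" using h unfolding good_def by blast
    then have "D' (?z \<circ>\<^sub>P b)" using D'_b by auto
    then have "D' (y \<circ>\<^sub>P (?z \<circ>\<^sub>P b))"
      using state_pcomp[OF st] r by (simp flip: pcomp_eq)
    then show ?thesis using f by (simp add: pcomp_eq[of b f] pcomp_assoc)
  qed
  ultimately show ?thesis unfolding good_def f by blast
qed

lemma good_pvalue:
  assumes st: "state t D (Some t) (b \<cdot>\<^sub>P (s \<cdot>\<^sub>P a))" and pn: "prenorm c (Some s) (s \<cdot>\<^sub>P a) as"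
    and as: "\<forall>g\<in>set as. good g"
  shows "good (pvalue c (s \<cdot>\<^sub>P a) as)"
proof -
  obtain v where v: "t \<le> v" and r: "case c of
      Dot \<Rightarrow> state t D (Some v) (b \<cdot>\<^sub>P pvalue c (s \<cdot>\<^sub>P a) as)
    | Circ \<Rightarrow> \<exists>f h. pvalue c (s \<cdot>\<^sub>P a) as = f \<circ>\<^sub>P h \<and> h \<in> set as \<and> state t D (Some v) (b \<cdot>\<^sub>P f) \<and> b \<circ>\<^sub>P h \<le> v"
    using prenorm_map_state[OF pn st less_s bs_t] as good_D' by blast
  show ?thesis
  proof (cases c)
    case Dot
    then have "state t D (Some v) (b \<cdot>\<^sub>P pvalue c (s \<cdot>\<^sub>P a) as)" using r by simp
    then show ?thesis using v b_less_t by (intro good_state) (auto intro: state_Some)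
  next
    case Circ
    then obtain f h where fh: "pvalue c (s \<cdot>\<^sub>P a) as = f \<circ>\<^sub>P h" "h \<in> set as"
      "state t D (Some v) (b \<cdot>\<^sub>P f)" "b \<circ>\<^sub>P h \<le> v" using r by auto
    have "good h" using as fh(2) by blast
    then show ?thesis by (rule good_comp[OF fh(3)]) (simp_all add: fh papp_comp)
  qed
qed

lemma good_D'_pvalue:
  assumes "prenorm c None b (a # as)" "good a" "\<forall>a\<in>set as. D' a"
  shows "D' (pvalue c b (a # as))"
proof (cases "as = []")
  case True
  then show ?thesis using assms good_D' by (cases c) (auto simp: good_def)
next
  case False
  then show ?thesis
    using assms extendible_pvalue[of D' "Some b" "b \<cdot>\<^sub>P a" as c]
    by (auto simp: good_def prenorm_Cons pvalue_Cons)
qed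

end

text \<open>To see that f is good, divide it by s: a longer s-form multiplied by b starts with b s =
  t, and its other factors become products of b with elements that are good by induction.\<close>

lemma divides_papp:
  assumes lin: "\<And>p q. D p \<Longrightarrow> D q \<Longrightarrow> comparable p q" and b: "divides D b" and s: "divides D s"
  shows "divides D (b \<cdot>\<^sub>P s)"
proof -
  let ?t = "b \<cdot>\<^sub>P s"
  have ext: "extendible D n None ?t" for n
    using divides_left_mult[OF lin b, of n None s] s unfolding divides_def by simp
  interpret division_step D b s ?t
    using lin b s ext less_imp_le[OF pcomp_less_papp] by unfold_locales auto
  have good: "good f" if "D f" for f
  proof -
    have "divform s D f" using that s unfolding divides_def by blast
    then show ?thesis
    proof (induction rule: divform.induct)
      case (atom f)
      show ?case
      proof (cases "f = s")
        case True
        then show ?thesis using good_state[OF state.init[of ?t D]] D'_t by simp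
      next
        case False
        then have "f < s" using atom by simp
        then show ?thesis using atom(2) by (intro good_le less_imp_le[OF pcomp_less_papp])
      qed
    next
      case (seq as c)
      then obtain a ds where as: "as = a # ds" by (cases as) auto
      have ga: "good a" using seq as by simp
      have st: "state ?t D (Some ?t) (b \<cdot>\<^sub>P (s \<cdot>\<^sub>P a))"
        using state.step[OF state.init good_D'[OF ga]] by (simp flip: papp_distrib)
      show ?case
      proof (cases "ds = []")
        case True
        show ?thesis
        proof (cases c)
          case Dot
          then show ?thesis using good_state[OF st] state_Some[OF st] b_less_t by (simp add: as True)
        next
          case Circ
          have "good (s \<circ>\<^sub>P a)" by (rule good_comp[OF state.init ga]) (simp_all add: papp_comp)
          then show ?thesis by (simp add: as True Circ)
        qed
      next
        case False
        then show ?thesis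
          using good_pvalue[OF st, of c ds] seq by (simp add: as prenorm_Cons pvalue_Cons)
      qed
    qed
  qed
  have "divform ?t D a" if "D a" for a
  proof -
    have "divform b D a" using that b unfolding divides_def by blast
    then show ?thesis
    proof (induction rule: divform.induct)
      case (atom a)
      then show ?case by (intro D'_le)
    next
      case (seq as c)
      then obtain a ds where as: "as = a # ds" by (cases as) auto
      then show ?case
        using good_D'_pvalue[of c a ds] seq good D'_D by auto
    qed
  qed
  then show ?thesis using ext unfolding divides_def by blast
qed

text \<open>Here b (s a) = t a: the factor a enters unmultiplied, so membership of a itself in D' is
  needed. Of a one knows only that it is below the given form; hence goodness is first shown below a
  level \<open>y\<close> up to which \<open>D\<close> is contained in D'.\<close>

lemma divides_pcomp:
  assumes lin: "\<And>p q. D p \<Longrightarrow> D q \<Longrightarrow> comparable p q" and b: "divides D b" and s: "divides D s"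
  shows "divides D (b \<circ>\<^sub>P s)"
proof -
  let ?t = "b \<circ>\<^sub>P s"
  have Ds: "D s" using divides_D[OF s] .
  have b_ext: "extendible D n None b" and s_ext: "extendible D n None s" for n
    using b s unfolding divides_def by auto
  have Dt: "D ?t" using b_ext[of "Suc 0"] Ds by auto
  have ext: "extendible D n None ?t" for n
  proof (cases n)
    case (Suc m)
    have "D (?t \<circ>\<^sub>P a) \<and> extendible D m (Some ?t) (?t \<cdot>\<^sub>P a)" if "D a" for a
    proof -
      have sa: "D (s \<circ>\<^sub>P a)" "extendible D m (Some s) (s \<cdot>\<^sub>P a)"
        using s_ext[of "Suc m"] that by auto
      then show ?thesis
        using divides_left_mult[OF lin b sa(2)] Ds b_ext[of "Suc 0"] by (simp add: comp_papp pcomp_assoc)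
    qed
    then show ?thesis using Suc Dt by simp
  qed (use Dt in simp)
  interpret division_step D b s ?t
    using lin b s ext less_imp_le[OF papp_less_pcomp] pcomp_mono[OF less_imp_le]
    by unfold_locales blast+
  have good: "good f" if "D f" "f < y" "\<And>c. D c \<Longrightarrow> c < y \<Longrightarrow> D' c" for f y
  proof -
    have "divform s D f" using that(1) s unfolding divides_def by blast
    then show ?thesis using that(2)
    proof (induction rule: divform.induct)
      case (atom f)
      then show ?case using pcomp_mono by (intro good_le) auto
    next
      case (seq as c)
      then obtain a ds where as: "as = a # ds" by (cases as) auto
      let ?f = "pvalue c s as"
      have Da: "divform s D a" using seq.IH as by simp
      have "s \<cdot>\<^sub>P a \<le> ?f" using pvalue_bounds[OF seq.hyps[unfolded as]] as by simp
      then have a: "a < ?f" using less_papp_self[OF Da] by order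
      then have D'a: "D' a"
        using that(3)[of a] seq.prems divides_divform[OF s] Da by (auto intro: less_trans)
      have st: "state ?t D (Some ?t) (b \<cdot>\<^sub>P (s \<cdot>\<^sub>P a))"
        using state.step[OF state.init D'a] by (simp add: comp_papp)
      show ?case
      proof (cases "ds = []")
        case True
        show ?thesis
        proof (cases c)
          case Dot
          then show ?thesis using good_state[OF st] state_Some[OF st] b_less_t by (simp add: as True)
        next
          case Circ
          have "good s" using Ds by (intro good_le) simp_all
          then have "good (s \<circ>\<^sub>P a)"
            by (rule good_comp[OF st]) (simp_all add: papp_comp pcomp_eq[of s a])
          then show ?thesis by (simp add: as True Circ)
        qed
      next
        case False
        then have pn: "prenorm c (Some s) (s \<cdot>\<^sub>P a) ds" using seq.hyps by (simp add: as prenorm_Cons)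
        have f: "?f = pvalue c (s \<cdot>\<^sub>P a) ds" using False by (simp add: as pvalue_Cons)
        have "good g" if "g \<in> set ds" for g
        proof -
          have "g < ?f" unfolding f by (rule prenorm_elem_less[OF pn _ that]) simp
          then show ?thesis using seq that by (auto simp: as intro: less_trans)
        qed
        then show ?thesis unfolding f using good_pvalue[OF st pn] by blast
      qed
    qed
  qed
  \<comment> \<open>Left multiplication by b is strictly increasing, so a b-form below b (y m) has
    its first factor below y m. This brings each level back to the preceding one.\<close>
  define y where "y m = ((\<cdot>\<^sub>P) b ^^ m) b" for m
  have y_Suc: "y (Suc m) = b \<cdot>\<^sub>P y m" for m by (simp add: y_def)
  have Dy: "D (y m)" for m
  proof (induction m)
    case 0
    show ?case using divides_D[OF b] by (simp add: y_def)
  next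
    case (Suc m)
    then show ?case using b_ext[of "Suc 0"] by (auto simp: y_Suc)
  qed
  have level: "D c \<Longrightarrow> c < y m \<Longrightarrow> D' c" for c m
  proof (induction m arbitrary: c)
    case 0
    then show ?case by (intro D'_le) (auto simp: y_def)
  next
    case (Suc m)
    have "divform b D c" using Suc.prems(1) b unfolding divides_def by blast
    then show ?case using Suc.prems(2)
    proof (induction rule: divform.induct)
      case (atom c)
      then show ?case by (intro D'_le)
    next
      case (seq as k)
      then obtain a ds where as: "as = a # ds" by (cases as) auto
      have Da: "D a" using seq.IH as divides_divform[OF b] by simp
      have "b \<cdot>\<^sub>P a \<le> pvalue k b as" using pvalue_bounds[OF seq.hyps[unfolded as]] as by simp
      then have "b \<cdot>\<^sub>P a < b \<cdot>\<^sub>P y m" using seq.prems y_Suc by (metis le_less_trans)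
      then have "a < y m"
        using lin[OF Da Dy[of m]] papp_mono_strict[of "y m" a b] by (auto simp: comparable_def)
      then have "good a" using good[OF Da _ Suc.IH] by blast
      moreover have "D' g" if "g \<in> set ds" for g
      proof -
        have ne: "ds \<noteq> []" using that by auto
        then have "prenorm k (Some b) (b \<cdot>\<^sub>P a) ds" using seq.hyps by (simp add: as prenorm_Cons)
        then have "g < pvalue k (b \<cdot>\<^sub>P a) ds" by (rule prenorm_elem_less[OF _ _ that]) simp
        then have "g < y (Suc m)" using seq.prems ne by (auto simp: as pvalue_Cons intro: less_trans)
        then show ?thesis using seq.IH that by (auto simp: as)
      qed
      ultimately show ?case using good_D'_pvalue seq.hyps unfolding as by blast
    qed
  qed
  \<comment> \<open>The levels exhaust \<open>D\<close>: a form with first factor a < y m is at most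
    b \<circ> a, which is below b (y m).\<close>
  have "\<exists>m. c < y m" if "D c" for c
  proof -
    have "divform b D c" using that b unfolding divides_def by blast
    then show ?thesis
    proof (induction rule: divform.induct)
      case (atom c)
      then have "c < b \<cdot>\<^sub>P b" using less_papp[of b b] by order
      then show ?case by (intro exI[of _ "Suc 0"]) (simp add: y_def)
    next
      case (seq as k)
      then obtain a ds where as: "as = a # ds" by (cases as) auto
      then obtain m where "a < y m" using seq.IH by auto
      moreover have "pvalue k b as \<le> b \<circ>\<^sub>P a" using pvalue_bounds[OF seq.hyps[unfolded as]] as by simp
      ultimately have "pvalue k b as < y (Suc m)"
        unfolding y_Suc using pcomp_less_papp[of a "y m" b] by (meson le_less_trans)
      then show ?case ..
    qed
  qed
  then show ?thesis using level ext unfolding divides_def by blast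
qed

section \<open>Forms over the generator and linearity of the order\<close>

abbreviation gen_forms :: "P \<Rightarrow> bool" where
  "gen_forms \<equiv> divform gen (\<lambda>p. p = gen)"

lemma gen_forms_comparable: "gen_forms p \<Longrightarrow> gen_forms q \<Longrightarrow> comparable p q"
proof (induction arbitrary: q rule: divform.induct)
  case (atom p)
  then show ?case using gen_le[of q] by (auto simp: comparable_def le_less)
next
  case (seq as c)
  from seq.prems show ?case
  proof cases
    case atom
    then show ?thesis using gen_le[of "pvalue c gen as"] gen_le[of q]
      unfolding comparable_def by (metis antisym order.order_iff_strict)
  next
    case seq': (seq as' c')
    have "\<forall>a\<in>set as. \<forall>a'\<in>set as'. comparable a a'"
      using seq.IH seq'(2) by blast
    then show ?thesis
      unfolding seq'(1) using comparable_pvalue seq.hyps seq'(3) by blast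
  qed
qed

lemma divides_gen_forms: "divides gen_forms u"
proof (induction u rule: P_induct)
  case gen
  have gen: "gen_forms gen" by (rule divform.atom) simp_all
  have "divform gen gen_forms a" if "gen_forms a" for a
    using that by (induction rule: divform.induct) (use gen in \<open>auto intro: divform.intros\<close>)
  then show ?case unfolding divides_def using state_extendible[OF state.init gen] by blast
next
  case (papp a b)
  then show ?case using divides_papp[OF gen_forms_comparable] by blast
next
  case (pcomp a b)
  then show ?case using divides_pcomp[OF gen_forms_comparable] by blast
qed

lemma gen_forms_all: "gen_forms = (\<lambda>_. True)"
  using divides_D[OF divides_gen_forms] by blast

lemma divform_all: "divform r (\<lambda>_. True) w"
  using divides_gen_forms[of r] unfolding divides_def gen_forms_all by simp

lemma P_linear: "(p::P) < q \<or> p = q \<or> q < p"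
  using gen_forms_comparable[of p q] unfolding gen_forms_all comparable_def by simp

section \<open>Formal division forms\<close>

lemma pvalue_snoc: "pvalue c p (as @ [a]) = (case c of Dot \<Rightarrow> foldl papp p as \<cdot>\<^sub>P a | Circ \<Rightarrow> foldl papp p as \<circ>\<^sub>P a)"
proof (induction as arbitrary: p)
  case (Cons b as)
  then show ?case by (simp add: pvalue_Cons split: opsym.split)
qed (cases c; simp)

lemma prenorm_append:
  "prenorm c q p (as @ b # bs) \<Longrightarrow> \<exists>q'. prenorm c q' (foldl papp p as) (b # bs)"
proof (induction as arbitrary: q p)
  case (Cons a as)
  then show ?case
    using prenorm_Cons[of "as @ b # bs" c q p a] Cons.IH[of "Some p" "p \<cdot>\<^sub>P a"] by simp
qed auto

lemma pvalue_append: "pvalue c p (as @ b # bs) = pvalue c (foldl papp p as) (b # bs)"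
  by (induction as arbitrary: p) (simp_all add: pvalue_Cons)

text \<open>The bridge to the indexed conditions of \<open>prenormal\<close>. The list omits the
  base, so factor k + 2 of a formal term is entry k + 1 here, compared with the product of the base
  and the first k entries.\<close>

lemma prenorm_iff_gen:
  "prenorm c q p as \<longleftrightarrow> as \<noteq> [] \<and> (if c = Circ \<and> length as = 1 then less_opt (hd as) q else le_opt (hd as) q) \<and>
    (\<forall>k. Suc k < length as \<longrightarrow> as ! Suc k \<le> foldl papp p (take k as)) \<and>
    (c = Circ \<and> 2 \<le> length as \<longrightarrow> last as < foldl papp p (take (length as - 2) as))"
proof (induction as arbitrary: q p)
  case (Cons a as)
  show ?case
  proof (cases as)
    case Nil
    then show ?thesis by (cases c) auto
  next
    case (Cons b bs)
    have all: "(\<forall>k. Q k) \<longleftrightarrow> Q 0 \<and> (\<forall>k. Q (Suc k))" for Q by (metis not0_implies_Suc)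
    have "prenorm c q p (a # as) \<longleftrightarrow> le_opt a q \<and> prenorm c (Some p) (p \<cdot>\<^sub>P a) as"
      by (simp add: prenorm_Cons Cons)
    also have "\<dots> \<longleftrightarrow> le_opt a q \<and> (if c = Circ \<and> length as = 1 then b < p else b \<le> p) \<and>
        (\<forall>k. Suc k < length as \<longrightarrow> as ! Suc k \<le> foldl papp (p \<cdot>\<^sub>P a) (take k as)) \<and>
        (c = Circ \<and> 2 \<le> length as \<longrightarrow> last as < foldl papp (p \<cdot>\<^sub>P a) (take (length as - 2) as))"
      unfolding Cons.IH by (simp add: Cons)
    also have "\<dots> \<longleftrightarrow> le_opt a q \<and> (\<forall>k. Suc k < length (a # as) \<longrightarrow> (a # as) ! Suc k \<le> foldl papp p (take k (a # as))) \<and>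
        (c = Circ \<longrightarrow> last as < foldl papp p (take (length as - 1) (a # as)))"
      by (subst (2) all) (cases bs; auto simp: Cons Suc_diff_le)
    finally show ?thesis by (simp add: Cons)
  qed
qed simp

lemma prenorm_iff:
  "prenorm c None p as \<longleftrightarrow> as \<noteq> [] \<and>
    (\<forall>k. Suc k < length as \<longrightarrow> as ! Suc k \<le> foldl papp p (take k as)) \<and>
    (c = Circ \<and> 2 \<le> length as \<longrightarrow> last as < foldl papp p (take (length as - 2) as))"
  unfolding prenorm_iff_gen by simp

definition mkterm :: "opsym \<Rightarrow> P \<Rightarrow> P trm list \<Rightarrow> P trm" where
  "mkterm c r ts = star c (foldl App (Var r) (butlast ts)) (last ts)"

lemma val_foldl: "val (foldl App s ts) = foldl papp (val s) (map val ts)"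
  by (induction ts arbitrary: s) simp_all

lemma val_mkterm: "ts \<noteq> [] \<Longrightarrow> val (mkterm c r ts) = pvalue c r (map val ts)"
  by (cases ts rule: rev_cases; cases c) (simp_all add: mkterm_def val_foldl pvalue_snoc)

lemma factors_foldl: "factors (foldl App s ts) = factors s @ ts"
  by (induction ts arbitrary: s) simp_all

lemma factors_mkterm: "ts \<noteq> [] \<Longrightarrow> factors (mkterm c r ts) = Var r # ts"
  by (cases c) (simp_all add: mkterm_def factors_foldl)

lemma lprod_Cons: "lprod (b # bs) = foldl App b bs"
  by (simp add: lprod_def)

lemma assoc_seq_Var: "assoc_seq (Var s) i = (if i = 0 then Some (Var s) else None)"
  by (simp add: assoc_seq_def)

lemma assoc_seq_mkterm:
  "ts \<noteq> [] \<Longrightarrow> assoc_seq (mkterm c r ts) i =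
    (if i \<le> length ts then Some ((Var r # ts) ! i)
     else if c = Dot then None
     else Some (iter (i - Suc (length ts)) (foldl App (Var r) (butlast ts)) (last ts)))"
  using factors_mkterm[of ts c r] unfolding assoc_seq_def
  by (cases c) (auto simp: mkterm_def less_Suc_eq_le)

text \<open>Values are compared through the partial products of associated sequences. The indices
  start at 1 because entry 0 is the base; for \<open>Circ\<close> terms the products go on past the
  factors.\<close>

definition prefix_term :: "P \<Rightarrow> P trm \<Rightarrow> nat \<Rightarrow> P trm" where
  "prefix_term r t k = foldl App (Var r) (map (\<lambda>i. the (assoc_seq t i)) [1..<k])"

lemma prefix_term_cong:
  "(\<And>i. i < k \<Longrightarrow> assoc_seq s i = assoc_seq t i) \<Longrightarrow> prefix_term r s k = prefix_term r t k"
  unfolding prefix_term_def by (intro arg_cong[of _ _ "foldl App (Var r)"] map_cong) auto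

lemma prefix_term_take:
  assumes "ts \<noteq> []" "k \<le> length ts"
  shows "prefix_term r (mkterm c r ts) (Suc k) = foldl App (Var r) (take k ts)"
proof -
  have "map (\<lambda>i. the (assoc_seq (mkterm c r ts) i)) [1..<Suc k] = take k ts"
    using assms by (intro nth_equalityI) (auto simp: assoc_seq_mkterm simp del: upt_Suc)
  then show ?thesis unfolding prefix_term_def by simp
qed

lemma prefix_term_Suc:
  "0 < k \<Longrightarrow> prefix_term r t (Suc k) = prefix_term r t k \<cdot> the (assoc_seq t k)"
  by (simp add: prefix_term_def)

text \<open>The partial product I_2 = u a is followed by the entry I_1 = u, which gives I_3, and so
  on: each entry of the tail is the previous partial product.\<close>

lemma prefix_term_iter:
  assumes "ts \<noteq> []"
  shows "prefix_term r (mkterm Circ r ts) (length ts + j) = iter j (foldl App (Var r) (butlast ts)) (last ts)"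
proof (induction j rule: induct_nat_012)
  case 0
  have "Suc (length ts - 1) = length ts" using assms by (cases ts) auto
  then show ?case
    using prefix_term_take[OF assms, of "length ts - 1" r Circ] by (simp add: butlast_conv_take)
next
  case 1
  have "foldl App (Var r) ts = foldl App (Var r) (butlast ts @ [last ts])" using assms by simp
  also have "\<dots> = foldl App (Var r) (butlast ts) \<cdot> last ts" by (simp only: foldl_append foldl.simps)
  finally show ?case using prefix_term_take[OF assms, of "length ts" r Circ] by simp
next
  case (ge2 j)
  then show ?case
    using prefix_term_Suc[of "length ts + Suc j" r "mkterm Circ r ts"] assms
    by (simp add: assoc_seq_mkterm)
qed

text \<open>Repeated use of a b \<circ> a = a \<circ> b. This is why the iterates represent u
  \<circ> a in the associated sequence.\<close>

lemma val_iter: "val (iter (Suc j) u a) \<circ>\<^sub>P val (iter j u a) = val u \<circ>\<^sub>P val a"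
proof (induction j)
  case 0
  then show ?case by (simp flip: pcomp_eq)
next
  case (Suc j)
  then show ?case by (simp flip: pcomp_eq)
qed

text \<open>Prenormality of values does not mention \<open>Lex\<close>, so it can be carried through
  the simultaneous induction over \<open>DF\<close> and \<open>Lex\<close>.\<close>

definition val_normal :: "P \<Rightarrow> P trm \<Rightarrow> bool" where
  "val_normal r t \<longleftrightarrow> (\<exists>s. t = Var s \<and> s \<le> r) \<or>
    (\<exists>c ts. ts \<noteq> [] \<and> t = mkterm c r ts \<and> prenorm c None r (map val ts))"

text \<open>The interval argument at an arbitrary position of the associated sequence. In the
  infinite tail the upper bound is attained, by \<open>val_iter\<close>.\<close>

lemma val_normal_bounds:
  assumes ts: "ts \<noteq> []" and pn: "prenorm c None r (map val ts)" and k: "0 < k"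
    and b: "assoc_seq (mkterm c r ts) k = Some b"
  defines "p \<equiv> val (prefix_term r (mkterm c r ts) k)"
  shows "p \<cdot>\<^sub>P val b \<le> val (mkterm c r ts) \<and> val (mkterm c r ts) \<le> p \<circ>\<^sub>P val b"
proof (cases "k \<le> length ts")
  case True
  then obtain j where j: "k = Suc j" "j < length ts" using k by (cases k) auto
  then have bj: "b = ts ! j" using b ts by (simp add: assoc_seq_mkterm)
  have "ts = take j ts @ ts ! j # drop (Suc j) ts" using j(2) by (rule id_take_nth_drop)
  then have split: "map val ts = map val (take j ts) @ val b # map val (drop (Suc j) ts)"
    unfolding bj by (metis list.simps(9) map_append)
  have p: "p = foldl papp r (map val (take j ts))"
    unfolding p_def j(1) using prefix_term_take[OF ts, of j] j(2) by (simp add: val_foldl)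
  obtain q where "prenorm c q p (val b # map val (drop (Suc j) ts))"
    using pn unfolding split p by (blast dest: prenorm_append)
  then show ?thesis
    unfolding val_mkterm[OF ts] split pvalue_append p[symmetric] by (rule pvalue_bounds)
next
  case False
  then obtain j where j: "k = length ts + Suc j" by (metis add_Suc_right less_imp_Suc_add not_le)
  then have c: "c = Circ" and bj: "b = iter j (foldl App (Var r) (butlast ts)) (last ts)"
    using b ts by (cases c; simp add: assoc_seq_mkterm)+
  have "p = val (iter (Suc j) (foldl App (Var r) (butlast ts)) (last ts))"
    unfolding p_def c j prefix_term_iter[OF ts] ..
  then have "p \<circ>\<^sub>P val b = val (mkterm c r ts)"
    unfolding bj by (simp add: val_iter c mkterm_def)
  then show ?thesis using papp_less_pcomp[of p "val b"] by simp
qed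

lemma val_mkterm_end:
  assumes ts: "ts \<noteq> []" and k: "\<forall>i<k. assoc_seq (mkterm c r ts) i \<noteq> None"
    and None: "assoc_seq (mkterm c r ts) k = None"
  shows "val (mkterm c r ts) = val (prefix_term r (mkterm c r ts) k)"
proof -
  have c: "c = Dot" and "length ts < k" using None ts by (auto simp: assoc_seq_mkterm split: if_splits)
  moreover have "\<not> Suc (length ts) < k" using k ts by (auto simp: assoc_seq_mkterm c)
  ultimately have "k = Suc (length ts)" by simp
  moreover have "pvalue Dot r (map val ts) = foldl papp r (map val ts)"
    using ts by (cases ts rule: rev_cases) (simp_all add: pvalue_snoc)
  ultimately show ?thesis
    using prefix_term_take[OF ts, of "length ts"] ts by (simp add: val_mkterm val_foldl c)
qed

lemma mkterm_cases:
  assumes "val_normal r t"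
  obtains s where "t = Var s" "s \<le> r"
  | c ts where "ts \<noteq> []" "t = mkterm c r ts" "prenorm c None r (map val ts)"
  using assms unfolding val_normal_def by blast

text \<open>Let p be the common partial product before the first difference. Then val s \<le> p
  \<circ> val a < p (val b) \<le> val t; if the sequence of s ends there, val s is the value of p
  itself.\<close>

lemma val_normal_less:
  assumes s: "val_normal r s" and t: "val_normal r t" and eq: "\<forall>i<k. assoc_seq s i = assoc_seq t i"
  shows "assoc_seq s k = None \<Longrightarrow> assoc_seq t k \<noteq> None \<Longrightarrow> val s < val t"
    and "assoc_seq s k = Some a \<Longrightarrow> assoc_seq t k = Some b \<Longrightarrow> val a < val b \<Longrightarrow> val s < val t"
proof -
  have 0: "assoc_seq (mkterm c r ts) 0 = Some (Var r)" if "ts \<noteq> []" for c ts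
    using that by (simp add: assoc_seq_mkterm)
  have gt: "r < val (mkterm c r ts)" if "ts \<noteq> []" "prenorm c None r (map val ts)" for c ts
    using less_pvalue that by (simp add: val_mkterm)
  {
    assume sk: "assoc_seq s k = None" and tk: "assoc_seq t k \<noteq> None"
    have s0: "assoc_seq s 0 \<noteq> None" using s 0 by (cases rule: mkterm_cases) (auto simp: assoc_seq_Var)
    then have k: "0 < k" using sk by (cases k) auto
    obtain d us where us: "us \<noteq> []" "t = mkterm d r us" "prenorm d None r (map val us)"
      using t tk k by (cases rule: mkterm_cases) (auto simp: assoc_seq_Var)
    obtain b where b: "assoc_seq t k = Some b" using tk by auto
    have "val (prefix_term r t k) \<cdot>\<^sub>P val b \<le> val t"
      using val_normal_bounds[OF us(1,3) k] b us(2) by blast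
    then have less: "val (prefix_term r t k) < val t"
      using less_papp[of "val (prefix_term r t k)" "val b"] by order
    from s show "val s < val t"
    proof (cases rule: mkterm_cases)
      case (1 p)
      then have "p = r" using eq k 0 us by (auto simp: assoc_seq_Var)
      then show ?thesis using gt us 1 by simp
    next
      case (2 c ts)
      have "\<forall>i<k. assoc_seq t i \<noteq> None" using us(1) b by (auto simp: us(2) assoc_seq_mkterm split: if_splits)
      then have "val s = val (prefix_term r s k)"
        using val_mkterm_end[of ts k c r] 2 eq sk by auto
      also have "prefix_term r s k = prefix_term r t k" using eq by (intro prefix_term_cong) auto
      finally show ?thesis using less by simp
    qed
  next
    assume sk: "assoc_seq s k = Some a" and tk: "assoc_seq t k = Some b" and ab: "val a < val b"
    show "val s < val t"
    proof (cases "k = 0")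
      case True
      from t have vb: "val b \<le> r \<and> val b \<le> val t"
        using tk gt True by (cases rule: mkterm_cases) (auto simp: assoc_seq_Var assoc_seq_mkterm intro: less_imp_le)
      from s show ?thesis
      proof (cases rule: mkterm_cases)
        case (1 p)
        then show ?thesis using sk True ab vb by (auto simp: assoc_seq_Var)
      next
        case (2 c ts)
        then show ?thesis using sk True ab vb by (auto simp: assoc_seq_mkterm)
      qed
    next
      case False
      obtain c ts where ts: "ts \<noteq> []" "s = mkterm c r ts" "prenorm c None r (map val ts)"
        using s sk False by (cases rule: mkterm_cases) (auto simp: assoc_seq_Var)
      obtain d us where us: "us \<noteq> []" "t = mkterm d r us" "prenorm d None r (map val us)"
        using t tk False by (cases rule: mkterm_cases) (auto simp: assoc_seq_Var)
      have p: "prefix_term r s k = prefix_term r t k" using eq by (intro prefix_term_cong) auto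
      have "val s \<le> val (prefix_term r s k) \<circ>\<^sub>P val a"
        using val_normal_bounds[OF ts(1,3)] False sk ts(2) by blast
      also have "\<dots> < val (prefix_term r t k) \<cdot>\<^sub>P val b"
        unfolding p by (rule pcomp_less_papp[OF ab])
      also have "\<dots> \<le> val t"
        using val_normal_bounds[OF us(1,3)] False tk us(2) by blast
      finally show ?thesis .
    qed
  }
qed

lemma prenormal_mkterm:
  "prenormal lt (Var r # ts) c \<longleftrightarrow>
    (\<forall>k. Suc k < length ts \<longrightarrow> lt (ts ! Suc k) (foldl App (Var r) (take k ts)) \<or> ts ! Suc k = foldl App (Var r) (take k ts)) \<and>
    (c = Circ \<and> 2 \<le> length ts \<longrightarrow> lt (last ts) (foldl App (Var r) (take (length ts - 2) ts)))"
proof -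
  have *: "2 \<le> length ts \<Longrightarrow> take (length ts - Suc 0) (Var r # ts) = Var r # take (length ts - 2) ts"
    by (simp add: take_Cons' diff_diff_left numeral_2_eq_2)
  show ?thesis
    unfolding prenormal_def by (auto simp: lprod_Cons * split: if_splits)
qed

lemma prenorm_of_prenormal:
  assumes "prenormal lt (Var r # ts) c" "ts \<noteq> []" and lt: "\<And>s t. lt s t \<Longrightarrow> val s < val t"
  shows "prenorm c None r (map val ts)"
proof -
  have "val (ts ! Suc k) \<le> foldl papp r (map val (take k ts))" if "Suc k < length ts" for k
  proof -
    have "lt (ts ! Suc k) (foldl App (Var r) (take k ts)) \<or> ts ! Suc k = foldl App (Var r) (take k ts)"
      using assms(1) that unfolding prenormal_mkterm by blast
    then show ?thesis
      using lt[of "ts ! Suc k" "foldl App (Var r) (take k ts)"] by (auto simp: val_foldl less_imp_le)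
  qed
  moreover have "val (last ts) < foldl papp r (map val (take (length ts - 2) ts))"
    if "c = Circ" "2 \<le> length ts"
    using assms(1) that lt[of "last ts" "foldl App (Var r) (take (length ts - 2) ts)"]
    unfolding prenormal_mkterm by (simp add: val_foldl)
  ultimately show ?thesis
    using assms(2) unfolding prenorm_iff by (auto simp: take_map last_map)
qed

lemma DF_mkterm:
  assumes "ts \<noteq> []" "\<forall>t\<in>set ts. DF r t" "prenormal (Lex r) (Var r # ts) c"
  shows "DF r (mkterm c r ts)"
  using DF_longer[of "butlast ts" r "last ts" c] assms
  by (auto simp: mkterm_def lprod_Cons dest: in_set_butlastD)

lemma DF_cases:
  assumes "DF r t"
  obtains s where "t = Var s" "s \<le> r"
  | c ts where "ts \<noteq> []" "t = mkterm c r ts" "\<forall>t\<in>set ts. DF r t" "prenormal (Lex r) (Var r # ts) c"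
  using assms
proof cases
  case (DF_longer as a c)
  then show ?thesis using that(2)[of "as @ [a]" c] by (auto simp: mkterm_def lprod_Cons)
qed (use that in \<open>auto simp: less_eq_P_def\<close>)

lemma DF_val_normal: "DF r t \<Longrightarrow> val_normal r t"
  and Lex_less: "Lex r s t \<Longrightarrow> val s < val t"
proof (induction rule: DF_Lex.inducts)
  case (DF_atom s)
  then show ?case by (auto simp: val_normal_def less_eq_P_def)
next
  case (DF_longer as a c)
  let ?ts = "as @ [a]"
  \<comment> \<open>Inside the simultaneous induction \<open>prenormal\<close> is available for
    \<open>Lex\<close> strengthened by the induction hypothesis, which is the relation passed on
    here.\<close>
  have "prenorm c None r (map val ?ts)"
    using DF_longer by (intro prenorm_of_prenormal[where lt = "\<lambda>s t. Lex r s t \<and> val s < val t"]) auto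
  then show ?case
    unfolding val_normal_def by (intro disjI2 exI[of _ c] exI[of _ ?ts]) (simp add: mkterm_def lprod_Cons)
next
  case (Lex_atom s t)
  then show ?case by (simp add: less_P_def)
next
  case (Lex_initial s t k)
  then show ?case using val_normal_less(1) by blast
next
  case (Lex_differ s t k a b)
  then show ?case using val_normal_less(2) by blast
qed

text \<open>An entry of \<open>t\<close> that is compared with an entry of the infinite tail of \<open>s\<close> is compared, by
  prenormality of \<open>t\<close>, with exactly this entry.\<close>

lemma tail_settled:
  assumes ts: "ts \<noteq> []" "s = mkterm c r ts" and us: "us \<noteq> []" "t = mkterm d r us"
    and pn: "prenormal (Lex r) (Var r # us) d"
    and k: "length ts < k" "k \<le> length us" and eq: "\<forall>i<k. assoc_seq s i = assoc_seq t i"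
    and a: "assoc_seq s k = Some a" and b: "assoc_seq t k = Some b"
  shows "Lex r b a \<or> b = a \<and> \<not> (d = Circ \<and> k = length us)"
proof -
  have c: "c = Circ" using a k(1) ts by (cases c) (auto simp: assoc_seq_mkterm)
  obtain j where j: "k = length ts + Suc j" using k(1) by (metis add_Suc_right less_imp_Suc_add)
  have aj: "a = iter j (foldl App (Var r) (butlast ts)) (last ts)"
    using a ts k(1) by (simp add: assoc_seq_mkterm c j)
  obtain l where l: "k = Suc (Suc l)" using j ts(1) by (cases ts) auto
  have "prefix_term r s (Suc l) = a"
    using prefix_term_iter[OF ts(1), of r j] aj j l ts(2) c by simp
  moreover have "prefix_term r s (Suc l) = prefix_term r t (Suc l)"
    using eq l by (intro prefix_term_cong) auto
  ultimately have a': "foldl App (Var r) (take l us) = a"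
    using prefix_term_take[OF us(1), of l r d] us(2) l k(2) by simp
  have b': "b = us ! Suc l" using b us k(2) l by (simp add: assoc_seq_mkterm)
  have "Lex r b a" if "d = Circ" "k = length us"
  proof -
    have "length us - 1 = Suc l" "length us - 2 = l" "2 \<le> length us" using that(2) l by auto
    then show ?thesis
      using pn that(1) a' b' us(1) unfolding prenormal_mkterm by (simp add: last_conv_nth)
  qed
  moreover have "Lex r b a \<or> b = a"
    using pn a' b' l k(2) Suc_le_lessD unfolding prenormal_mkterm by blast
  ultimately show ?thesis by blast
qed

lemma Lex_irrefl: "\<not> Lex r s s"
  using Lex_less by blast

text \<open>At position \<open>length us\<close> the tail of s would have to agree with the last
  factor of t, but prenormality for \<open>Circ\<close> makes that factor strictly smaller than the
  tail entry.\<close>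

lemma no_longer_circ:
  assumes ts: "ts \<noteq> []" "s = mkterm c r ts" and us: "us \<noteq> []" "t = mkterm Circ r us"
    and pn: "prenormal (Lex r) (Var r # us) Circ" and l: "length ts < length us"
    and eq: "\<forall>i\<le>length us. assoc_seq s i = assoc_seq t i"
  shows False
proof -
  obtain b where b: "assoc_seq t (length us) = Some b" using us by (simp add: assoc_seq_mkterm)
  then have "assoc_seq s (length us) = Some b" using eq by simp
  from tail_settled[OF ts us pn l _ _ this b] show False using eq Lex_irrefl by auto
qed

lemma mkterm_eqI:
  assumes "ts \<noteq> []" "us \<noteq> []" "length ts = length us"
    "\<forall>i\<le>length us. assoc_seq (mkterm c r ts) i = assoc_seq (mkterm d r us) i"
  shows "ts = us"
proof (rule nth_equalityI[OF assms(3)])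
  fix i assume "i < length ts"
  then show "ts ! i = us ! i" using assms(4)[rule_format, of "Suc i"] assms(1-3) by (simp add: assoc_seq_mkterm)
qed

lemma assoc_seq_inject:
  assumes ts: "ts \<noteq> []" "s = mkterm c r ts" "prenormal (Lex r) (Var r # ts) c"
    and us: "us \<noteq> []" "t = mkterm d r us" "prenormal (Lex r) (Var r # us) d"
    and eq: "assoc_seq s = assoc_seq t"
  shows "s = t"
proof -
  have circ: "c = Circ \<longleftrightarrow> d = Circ"
  proof -
    \<comment> \<open>A position beyond both lists: there the sequence of a \<open>Dot\<close> term
      has ended and that of a \<open>Circ\<close> term goes on.\<close>
    have "assoc_seq (mkterm e r vs) (length ts + Suc (length us)) = None \<longleftrightarrow> e = Dot"
      if "vs = ts \<or> vs = us" for e vs using that ts us by (cases e) (auto simp: assoc_seq_mkterm)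
    then have "c = Dot \<longleftrightarrow> d = Dot" using eq ts(2) us(2) by metis
    then show ?thesis by (cases c; cases d) auto
  qed
  have "length ts = length us"
  proof (cases "d = Circ")
    case True
    then show ?thesis
      using no_longer_circ[OF ts(1,2) us(1)] no_longer_circ[OF us(1,2) ts(1)] ts us circ eq
      by (metis linorder_neqE_nat)
  next
    case False
    then have cd: "c = Dot" "d = Dot" using circ by (cases c; cases d; auto)+
    have "assoc_seq t (Suc (length ts)) = None" "assoc_seq s (Suc (length us)) = None"
      using ts us unfolding eq[symmetric] by (simp add: cd assoc_seq_mkterm)
        (use us in \<open>simp add: eq cd assoc_seq_mkterm\<close>)
    then have "\<not> Suc (length ts) \<le> length us" "\<not> Suc (length us) \<le> length ts"
      using ts us by (auto simp: cd assoc_seq_mkterm)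
    then show ?thesis by linarith
  qed
  then have "ts = us" using mkterm_eqI[OF ts(1) us(1), of c r d] eq ts(2) us(2) by simp
  moreover have "c = d" using circ by (cases c; cases d) auto
  ultimately show ?thesis using ts us by simp
qed

lemma size_foldl: "t \<in> set ts \<Longrightarrow> size t < size (foldl App s ts)"
  by (induction ts rule: rev_induct) auto

lemma size_mkterm: "ts \<noteq> [] \<Longrightarrow> t \<in> set ts \<Longrightarrow> size t < size (mkterm c r ts)"
  using size_foldl[of t "butlast ts" "Var r"]
  by (cases ts rule: rev_cases; cases c) (auto simp: mkterm_def)

text \<open>Induction on the size of s suffices: at the first difference either both entries are
  factors, hence smaller, or \<open>tail_settled\<close> decides without recursion. Two tails never
  differ first, since by \<open>no_longer_circ\<close> the factor lists would then coincide.\<close>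

lemma Lex_total: "DF r s \<Longrightarrow> DF r t \<Longrightarrow> s = t \<or> Lex r s t \<or> Lex r t s"
proof (induction s arbitrary: t rule: measure_induct_rule[of size])
  case (less s)
  have atom: "Lex r (Var p) u" if "p \<le> r" "us \<noteq> []" "u = mkterm d r us" "DF r u" for p d us u
  proof (cases "p = r")
    case True
    have p: "DF r (Var p)" by (intro DF_atom) (simp add: True)
    show ?thesis
      by (rule Lex_initial[OF p that(4), of 1]) (use that True in \<open>auto simp: assoc_seq_Var assoc_seq_mkterm Suc_le_eq\<close>)
  next
    case False
    have p: "DF r (Var p)" "DF r (Var r)" using that(1) by (auto intro!: DF_atom simp: less_eq_P_def)
    have "Lex r (Var p) (Var r)" using p that(1) False by (intro Lex_atom) (auto simp: less_eq_P_def)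
    then show ?thesis
      by (intro Lex_differ[OF p(1) that(4), of 0 "Var p" "Var r"]) (use that in \<open>auto simp: assoc_seq_Var assoc_seq_mkterm\<close>)
  qed
  from less.prems(1) show ?case
  proof (cases rule: DF_cases)
    case s: (1 p)
    from less.prems(2) show ?thesis
    proof (cases rule: DF_cases)
      case t: (1 q)
      then show ?thesis using P_linear[of p q] less.prems s by (auto intro: Lex_atom simp: less_P_def)
    next
      case (2 d us)
      then show ?thesis using atom s less.prems by blast
    qed
  next
    case ts: (2 c ts)
    from less.prems(2) show ?thesis
    proof (cases rule: DF_cases)
      case (1 q)
      then show ?thesis using atom ts less.prems by blast
    next
      case us: (2 d us)
      show ?thesis
      proof (cases "assoc_seq s = assoc_seq t")
        case True
        then show ?thesis using assoc_seq_inject ts us by blast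
      next
        case False
        define k where "k = (LEAST k. assoc_seq s k \<noteq> assoc_seq t k)"
        have ne: "assoc_seq s k \<noteq> assoc_seq t k"
          using False LeastI_ex[of "\<lambda>k. assoc_seq s k \<noteq> assoc_seq t k"] unfolding k_def by auto
        have eq: "\<forall>i<k. assoc_seq s i = assoc_seq t i"
          unfolding k_def using not_less_Least by blast
        have eq': "\<forall>i<k. assoc_seq t i = assoc_seq s i" using eq by simp
        show ?thesis
        proof (cases "assoc_seq s k = None \<or> assoc_seq t k = None")
          case True
          then show ?thesis
            using Lex_initial[OF less.prems eq] Lex_initial[OF less.prems(2,1) eq'] ne by metis
        next
          case some: False
          then obtain a b where ab: "assoc_seq s k = Some a" "assoc_seq t k = Some b" "a \<noteq> b"
            using ne by auto
          have "0 < k" using ne ts us by (cases k) (auto simp: assoc_seq_mkterm)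
          then obtain i where i: "k = Suc i" by (cases k) auto
          have "Lex r a b \<or> Lex r b a"
          proof -
            consider "k \<le> length ts" "k \<le> length us" | "length ts < k" "k \<le> length us"
              | "k \<le> length ts" "length us < k" | "length ts < k" "length us < k" by linarith
            then show ?thesis
            proof cases
              case 1
              then have "a \<in> set ts" "b \<in> set us" using ab ts us i by (auto simp: assoc_seq_mkterm)
              then show ?thesis using less.IH[of a b] size_mkterm ts us ab(3) by auto
            next
              case 2
              then show ?thesis using tail_settled[OF ts(1,2) us(1,2,4) _ _ eq ab(1,2)] ab(3) by auto
            next
              case 3
              then show ?thesis using tail_settled[OF us(1,2) ts(1,2,4) _ _ eq' ab(2,1)] ab(3) by auto
            next
              case 4
              then have c: "c = Circ" and d: "d = Circ"
                using ab ts us by (cases c; cases d; auto simp: assoc_seq_mkterm)+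
              have "length ts = length us"
                using no_longer_circ[OF ts(1,2) us(1)] no_longer_circ[OF us(1,2) ts(1)] ts us c d eq eq' 4
                by (metis le_less_trans linorder_neqE_nat)
              then have "ts = us" using mkterm_eqI[OF ts(1) us(1), of c r d] eq ts(2) us(2) 4 by auto
              then show ?thesis using ne ts us c d by simp
            qed
          qed
          then show ?thesis
            using Lex_differ[OF less.prems eq ab(1,2)] Lex_differ[OF less.prems(2,1) eq' ab(2,1)] by blast
        qed
      qed
    qed
  qed
qed

lemma DF_val_inject: "DF r s \<Longrightarrow> DF r t \<Longrightarrow> val s = val t \<Longrightarrow> s = t"
  using Lex_total Lex_less by fastforce

lemma Lex_iff: "DF r s \<Longrightarrow> DF r t \<Longrightarrow> Lex r s t \<longleftrightarrow> val s < val t"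
  using Lex_total[of r s t] Lex_less by (metis less_asym less_irrefl)

text \<open>Inequalities of values turn into \<open>Lex\<close> only between members of
  \<open>DF\<close>, so the prefix products must be in \<open>DF\<close> too. They are shorter forms
  with \<open>Dot\<close>, whence the induction on length for arbitrary \<open>c\<close>.\<close>

lemma DF_mkterm_val:
  "\<forall>t\<in>set ts. DF r t \<Longrightarrow> prenorm c None r (map val ts) \<Longrightarrow> DF r (mkterm c r ts)"
proof (induction ts arbitrary: c rule: length_induct)
  case (1 ts)
  have ts: "ts \<noteq> []" using "1.prems"(2) by auto
  have pre: "DF r (foldl App (Var r) (take k ts))" if "k < length ts" for k
  proof (cases "k = 0")
    case True
    then show ?thesis by (auto intro: DF_atom)
  next
    case False
    have "prenorm Dot None r (map val (take k ts))"
      using "1.prems"(2) False that unfolding prenorm_iff by (auto simp: take_map min_def)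
    then have "DF r (mkterm Dot r (take k ts))"
      using "1.IH"[rule_format, of "take k ts" Dot] "1.prems"(1) that by (auto dest: in_set_takeD)
    moreover have "mkterm Dot r (take k ts) = foldl App (Var r) (butlast (take k ts) @ [last (take k ts)])"
      unfolding mkterm_def by (simp only: star.simps foldl_append foldl.simps)
    ultimately show ?thesis using False ts by simp
  qed
  have "prenormal (Lex r) (Var r # ts) c"
    unfolding prenormal_mkterm
  proof (intro conjI allI impI)
    fix k assume k: "Suc k < length ts"
    then have "DF r (ts ! Suc k)" "DF r (foldl App (Var r) (take k ts))" using "1.prems"(1) pre by auto
    moreover have "val (ts ! Suc k) \<le> val (foldl App (Var r) (take k ts))"
      using "1.prems"(2) k unfolding prenorm_iff by (auto simp: val_foldl take_map)
    ultimately show "Lex r (ts ! Suc k) (foldl App (Var r) (take k ts)) \<or> ts ! Suc k = foldl App (Var r) (take k ts)"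
      using Lex_iff DF_val_inject by (auto simp: order.order_iff_strict)
  next
    assume c: "c = Circ \<and> 2 \<le> length ts"
    then have "DF r (last ts)" "DF r (foldl App (Var r) (take (length ts - 2) ts))"
      using "1.prems"(1) pre ts by auto
    moreover have "val (last ts) < val (foldl App (Var r) (take (length ts - 2) ts))"
      using "1.prems"(2) c ts unfolding prenorm_iff by (auto simp: val_foldl take_map last_map)
    ultimately show "Lex r (last ts) (foldl App (Var r) (take (length ts - 2) ts))"
      using Lex_iff by blast
  qed
  then show ?case using DF_mkterm ts "1.prems"(1) by blast
qed

lemma DF_exists: "\<exists>t. DF r t \<and> val t = w"
  using divform_all[of r w]
proof (induction rule: divform.induct)
  case (atom a)
  then show ?case by (intro exI[of _ "Var a"]) (auto intro: DF_atom simp: less_eq_P_def)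
next
  case (seq as c)
  then obtain f where f: "\<forall>a\<in>set as. DF r (f a) \<and> val (f a) = a" by metis
  then have m: "map val (map f as) = as" by (simp add: map_idI)
  then have "DF r (mkterm c r (map f as))"
    using f seq.hyps by (intro DF_mkterm_val) (auto simp del: map_map)
  moreover have "val (mkterm c r (map f as)) = pvalue c r as"
    using val_mkterm[of "map f as" c r] m seq.hyps by (cases as) auto
  ultimately show ?case by blast
qed

theorem mainTheorem8:
  fixes w r :: P
  shows "\<exists>!t. DF r t \<and> val t = w"
  using DF_exists[of r w] DF_val_inject[of r] by blast

end
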